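(* Let $\mathcal{W}$ be a class of symmetric binary-input discrete memoryless channels that is one-sided with respect to the uniform input distribution. Consider the polar successive cancellation decoder using the mismatched decoding rule for the channel $V=\arg\min_{W\in\mathsf{cl}(\mathcal{W})}I(W)$, and the class of polar codes with the information sets $$\mathcal{A}_N^{\epsilon}(W,V)=\{i=1,\dots,N: I(W_N^{(i)},V_N^{(i)})\ge 1-\epsilon\},$$ where $W\in\mathcal{W}$, $N=2^n$ with $n=1,2,\dots$ is the blocklength, and $\epsilon>0$ is a desired threshold. Then, for any $R<I(V)$, one can select $\epsilon\sim O(2^{-\sqrt{N}})$ and construct for all $W\in\mathcal{W}$ the information sets $\mathcal{A}_N^{\epsilon}(W,V)$ of size at least as large as $NR$. Moreover, the resulting decoding error probability over any channel $W\in\mathcal{W}$ of the corresponding polar code (with information set $\mathcal{A}_N^{\epsilon}(W,V)$, decoded by the successive cancellation decoder for $V$) can be made arbitrarily small by taking $N\to\infty$. In that sense, the polar successive cancellation decoder is universally compound capacity achieving over one-sided sets of symmetric channels.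
   Context: A binary-input discrete memoryless channel (B-DMC) $W$ with discrete output alphabet $\mathcal{Y}$ is given by transition probabilities $W(y|x)$, $x\in\mathbb{F}_2=\{0,1\}$, $y\in\mathcal{Y}$; all channels in $\mathcal{W}$ share the output alphabet $\mathcal{Y}$. It is symmetric if there is a permutation $\pi$ of $\mathcal{Y}$ with $\pi^{-1}=\pi$ and $W(y|1)=W(\pi(y)|0)$ for all $y$. Put $q_W(y)=\frac12(W(y|0)+W(y|1))$. Logarithms are to base $2$. Channel inputs are uniformly distributed. For B-DMCs $W,V$ with the same output alphabet, $I(W,V)=\sum_y\sum_{x\in\{0,1\}}\frac12W(y|x)\log\frac{V(y|x)}{q_V(y)}$, where terms with $W(y|x)=0$ are $0$ and terms with $W(y|x)>0$, $V(y|x)=0$ are $-\infty$. The symmetric capacity is $I(W)=I(W,W)$. One-sided set: $\mathcal{W}$ is one-sided with respect to the uniform input distribution if the minimizer $V=\arg\min_{W\in\mathsf{cl}(\mathcal{W})}I(W)$ is unique, where $\mathsf{cl}(\mathcal{W})$ is the closure of $\mathcal{W}$, and if $I(W,V)\ge I(V)$ for all $W\in\mathcal{W}$. Compound capacity: for a class $\mathcal{W}$ of symmetric channels, the compound capacity is $\min_{W\in\mathcal{W}}I(W)$. Synthetic channels: for $N=2^n$ and $i=1,\dots,N$, $W_N^{(i)}$ is a channel from $\mathbb{F}_2$ to $\mathcal{Y}^N\times\mathbb{F}_2^{i-1}$, obtained (up to relabelling of outputs) by the recursion $W_1^{(1)}=W$, $W_{2N}^{(2i-1)}=(W_N^{(i)})^-$,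 $W_{2N}^{(2i)}=(W_N^{(i)})^+$, where $W^-(y_1y_2|u_1)=\sum_{u_2\in\mathbb{F}_2}\frac12W(y_1|u_1\oplus u_2)W(y_2|u_2)$ and $W^+(y_1y_2u_1|u_2)=\frac12W(y_1|u_1\oplus u_2)W(y_2|u_2)$. Equivalently, with $G_N=B_NF^{\otimes n}$ over $\mathbb{F}_2$, $F=\begin{pmatrix}1&0\\1&1\end{pmatrix}$ and $B_N$ the bit-reversal permutation matrix, $$W_N^{(i)}(y_1^N,u_1^{i-1}|u_i)=\sum_{u_{i+1}^N\in\mathbb{F}_2^{N-i}}\frac1{2^{N-1}}\prod_{j=1}^N W\big(y_j\,|\,(u_1^NG_N)_j\big).$$ $V_N^{(i)}$ is defined likewise from $V$. Polar code with information set $\mathcal{A}\subseteq\{1,\dots,N\}$: the data bits are $u_i$, $i\in\mathcal{A}$; the bits $u_i$, $i\notin\mathcal{A}$, are frozen and known to the decoder; the codeword $x_1^N=u_1^NG_N$ is sent over $N$ independent uses of $W$, giving $y_1^N$. Mismatched successive cancellation decoder for $V$: for $i=1,\dots,N$ in order, $\hat u_i=u_i$ if $i\notin\mathcal{A}$, and otherwise $\hat u_i$ is a value $u\in\mathbb{F}_2$ maximizing $V_N^{(i)}(y_1^N,\hat u_1^{i-1}|u)$. The decoding error probability over $W$ is the probability that $\hat u_i\ne u_i$ for some $i\in\mathcal{A}$ when the channel is $W$ and $u_1^N$ is uniformly distributed.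
   Formalization: The threshold rate O(2^{-√N}), which fails as stated (e.g. for the class {BEC(0.01)} and 1/2 < R < 0.99), is replaced by one sequence ε_N that is O(2^{-N^β}) for every β < 1/2; sizes at least NR are claimed for all sufficiently large N. *)

theory Defs
  imports "HOL-Analysis.Analysis" "HOL-Library.Z2" "HOL-Library.Landau_Symbols"
begin

text \<open>
  The field with two elements is the type \<^typ>\<open>bit\<close>. A binary-input channel is a
  transition function: \<open>W x y\<close> is the probability of output \<open>y\<close> given input \<open>x\<close>.
  Positions in a block of length \<open>N\<close> are numbered \<open>0, \<dots>, N - 1\<close>, so the index \<open>i\<close> below
  is one less than in the usual numbering \<open>1, \<dots>, N\<close>.
\<close>

type_synonym 'o channel = "bit \<Rightarrow> 'o \<Rightarrow> real"

definition is_channel :: "('y::finite) channel \<Rightarrow> bool" where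
  "is_channel W \<longleftrightarrow> (\<forall>x y. 0 \<le> W x y) \<and> (\<forall>x. (\<Sum>y\<in>UNIV. W x y) = 1)"

definition symmetric_channel :: "('y::finite) channel \<Rightarrow> bool" where
  "symmetric_channel W \<longleftrightarrow> is_channel W \<and>
     (\<exists>\<pi>. bij \<pi> \<and> inv \<pi> = \<pi> \<and> (\<forall>y. W 1 y = W 0 (\<pi> y)))"

definition output_dist :: "'o channel \<Rightarrow> 'o \<Rightarrow> real" where
  "output_dist V y = (V 0 y + V 1 y) / 2"

text \<open>
  The output alphabet \<open>Y\<close> is an explicit argument because the synthetic channels below have
  sets of lists as output alphabets. No summand is \<open>+\<infinity>\<close>, so the sum is never of the form
  \<open>\<infinity> - \<infinity>\<close>.
\<close>

definition mismatched_info :: "'o set \<Rightarrow> 'o channel \<Rightarrow> 'o channel \<Rightarrow> ereal" where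
  "mismatched_info Y W V =
     (\<Sum>y\<in>Y. \<Sum>x\<in>{0, 1}.
        if W x y = 0 then 0
        else if V x y = 0 then - \<infinity>
        else ereal (1 / 2 * W x y * log 2 (V x y / output_dist V y)))"

definition symmetric_capacity :: "('y::finite) channel \<Rightarrow> ereal" where
  "symmetric_capacity W = mismatched_info UNIV W W"

definition compound_capacity :: "('y::finite) channel set \<Rightarrow> ereal" where
  "compound_capacity \<W> = (INF W\<in>\<W>. symmetric_capacity W)"

text \<open>
  The closure is taken in the product topology on \<^typ>\<open>bit \<Rightarrow> 'y \<Rightarrow> real\<close>; as both index
  types are finite, this is the Euclidean topology on transition matrices.
\<close>

definition worst_channel :: "('y::finite) channel set \<Rightarrow> 'y channel" where
  "worst_channel \<W> = (ARG_MIN symmetric_capacity U. U \<in> closure \<W>)"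

definition one_sided :: "('y::finite) channel set \<Rightarrow> bool" where
  "one_sided \<W> \<longleftrightarrow>
     (\<exists>!V. is_arg_min symmetric_capacity (\<lambda>U. U \<in> closure \<W>) V) \<and>
     (\<forall>W\<in>\<W>. symmetric_capacity (worst_channel \<W>) \<le> mismatched_info UNIV W (worst_channel \<W>))"

definition kernel :: "nat \<Rightarrow> nat \<Rightarrow> bit" where
  "kernel i j = (if i = 0 \<and> j = 1 then 0 else 1)"

text \<open>Entries of the \<open>n\<close>-fold Kronecker power of the kernel, for row and column below \<open>2 ^ n\<close>.\<close>

primrec kernel_power :: "nat \<Rightarrow> nat \<Rightarrow> nat \<Rightarrow> bit" where
  "kernel_power 0 i j = 1"
| "kernel_power (Suc n) i j =
     kernel (i div 2 ^ n) (j div 2 ^ n) * kernel_power n (i mod 2 ^ n) (j mod 2 ^ n)"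

primrec bit_reversal :: "nat \<Rightarrow> nat \<Rightarrow> nat" where
  "bit_reversal 0 i = 0"
| "bit_reversal (Suc n) i = (i mod 2) * 2 ^ n + bit_reversal n (i div 2)"

text \<open>
  Multiplying on the left by the bit-reversal permutation matrix permutes the rows.
\<close>

definition polar_generator :: "nat \<Rightarrow> nat \<Rightarrow> nat \<Rightarrow> bit" where
  "polar_generator n i j = kernel_power n (bit_reversal n i) j"

definition polar_encode :: "nat \<Rightarrow> bit list \<Rightarrow> bit list" where
  "polar_encode n us = map (\<lambda>j. \<Sum>i<2 ^ n. us ! i * polar_generator n i j) [0..<2 ^ n]"

definition synthetic_outputs :: "nat \<Rightarrow> nat \<Rightarrow> ('y list \<times> bit list) set" where
  "synthetic_outputs n i = {(ys, us). length ys = 2 ^ n \<and> length us = i}"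

text \<open>
  The list \<open>vs\<close> ranges over the values of the inputs that follow the current bit \<open>u\<close>.
\<close>

definition synthetic_channel ::
  "nat \<Rightarrow> nat \<Rightarrow> 'y channel \<Rightarrow> ('y list \<times> bit list) channel" where
  "synthetic_channel n i W u = (\<lambda>(ys, us).
     \<Sum>vs | length vs = 2 ^ n - 1 - i.
       1 / 2 ^ (2 ^ n - 1) * (\<Prod>j<2 ^ n. W (polar_encode n (us @ u # vs) ! j) (ys ! j)))"

definition information_set ::
  "nat \<Rightarrow> real \<Rightarrow> ('y::finite) channel \<Rightarrow> 'y channel \<Rightarrow> nat set" where
  "information_set n \<epsilon> W V =
     {i. i < 2 ^ n \<and>
         ereal (1 - \<epsilon>) \<le> mismatched_info (synthetic_outputs n i)
                            (synthetic_channel n i W) (synthetic_channel n i V)}"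

text \<open>
  The decision \<open>d i ys hs\<close> for bit \<open>i\<close> depends on the channel output \<open>ys\<close> and the list \<open>hs\<close> of
  earlier decisions. Ties may be broken in any way.
\<close>

definition mismatched_rule ::
  "nat \<Rightarrow> ('y::finite) channel \<Rightarrow> (nat \<Rightarrow> 'y list \<Rightarrow> bit list \<Rightarrow> bit) \<Rightarrow> bool" where
  "mismatched_rule n V d \<longleftrightarrow>
     (\<forall>i<2 ^ n. \<forall>(ys, hs) \<in> synthetic_outputs n i.
        is_arg_max (\<lambda>u. synthetic_channel n i V u (ys, hs)) (\<lambda>_. True) (d i ys hs))"

text \<open>
  The first \<open>k\<close> decisions. Only the frozen positions of the input \<open>us\<close> are used.
\<close>

primrec sc_decode ::
  "(nat \<Rightarrow> 'y list \<Rightarrow> bit list \<Rightarrow> bit) \<Rightarrow> nat set \<Rightarrow> bit list \<Rightarrow> 'y list \<Rightarrow> nat \<Rightarrow> bit list" where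
  "sc_decode d A us ys 0 = []"
| "sc_decode d A us ys (Suc k) =
     (let hs = sc_decode d A us ys k in hs @ [if k \<in> A then d k ys hs else us ! k])"

definition error_probability ::
  "nat \<Rightarrow> ('y::finite) channel \<Rightarrow> nat set \<Rightarrow> (nat \<Rightarrow> 'y list \<Rightarrow> bit list \<Rightarrow> bit) \<Rightarrow> real" where
  "error_probability n W A d =
     (\<Sum>us | length us = 2 ^ n. \<Sum>ys | length ys = 2 ^ n.
        1 / 2 ^ (2 ^ n) * (\<Prod>j<2 ^ n. W (polar_encode n us ! j) (ys ! j)) *
        of_bool (\<exists>i\<in>A. sc_decode d A us ys (2 ^ n) ! i \<noteq> us ! i))"

end

theory Submission
  imports Defs "HOL-Real_Asymp.Real_Asymp"
begin

text \<open>
  Everything is determined by the law of the likelihood ratio \<open>L = V(y|x+1) / V(y|x)\<close> for uniform \<open>x\<close>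
  and \<open>y\<close> distributed as \<open>W(.|x)\<close>: \<open>I(W,V) = 1 - X\<close> with \<open>X = E log\<^sub>2 (1 + L)\<close>, and a wrong decision
  forces \<open>L \<ge> 1\<close>, so that its probability is at most \<open>X\<close>. The two polarization steps replace \<open>L\<close> by
  \<open>(L\<^sub>1 + L\<^sub>2) / (1 + L\<^sub>1 L\<^sub>2)\<close> and \<open>L\<^sub>1 L\<^sub>2\<close> with independent copies of \<open>L\<close>. The product of the two
  values of \<open>1 + L\<close> is \<open>(1 + L\<^sub>1) (1 + L\<^sub>2)\<close>, so \<open>X\<close> is a nonnegative martingale along a random
  sequence of steps, and \<open>X \<le> 1 - I(V)\<close> at the start by one-sidedness.

  It remains to show that \<open>X\<close> becomes tiny except with probability about its initial value. In contrast to
  the matched case, \<open>X\<close> can be dominated by huge values of \<open>L\<close> of small probability. The mean \<open>T\<close> of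
  \<open>(1 - L) / (1 + L)\<close> is squared by a minus step, and \<open>X \<ge> 1 - T / ln 2\<close>; hence a bounded run of minus
  steps pushes \<open>X\<close> from below \<open>1 - \<eta>\<close> to nearly \<open>1\<close>, unless \<open>T\<close> is near \<open>1\<close>. As \<open>exp (- X)\<close> is a bounded
  submartingale, this cannot happen often, and at some early time either \<open>X \<ge> 1 - \<eta>\<close> or \<open>L\<close> is small with
  high probability. In the second case the capped moment \<open>E min (L\<^bsup>1/z\<^esup>, 2)\<close> stays small while
  the scale \<open>z\<close> grows by the factor \<open>4/3\<close> at every plus step, because the cap is exceeded with probability at
  most \<open>X / z\<close>. Finally \<open>E (1 + L)\<^sup>\<rho> - 1\<close> stays small over a time of order \<open>1 / \<rho>\<close>, which removes the cap.
  Once \<open>E L\<^sup>\<theta>\<close> is small for some \<open>\<theta>\<close>, it decays doubly exponentially: it is squared by a plus step and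
  at most doubled by a minus step.
\<close>

section \<open>Laws of likelihood ratios\<close>

text \<open>A normalized positive linear functional on all real functions. The order is tested on
  the nonnegative reals only, so values at negative arguments have no influence. Likelihood ratios
  over finite alphabets take finitely many values, so every function of them can be
  averaged.\<close>

definition is_expectation :: "((real \<Rightarrow> real) \<Rightarrow> real) \<Rightarrow> bool" where
  "is_expectation E \<longleftrightarrow> (\<forall>f g. E (\<lambda>x. f x + g x) = E f + E g) \<and> (\<forall>c f. E (\<lambda>x. c * f x) = c * E f) \<and>
     (\<forall>f g. (\<forall>x\<ge>0. f x \<le> g x) \<longrightarrow> E f \<le> E g) \<and> E (\<lambda>_. 1) = 1"

text \<open>A law on \<open>[0, \<infinity>)\<close> is represented by its expectation functional.\<close>

typedef law = "{E. is_expectation E}" morphisms mean Abs_law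
proof
  show "(\<lambda>f. f 0) \<in> {E. is_expectation E}" by (simp add: is_expectation_def)
qed

lemma mean_Abs_law: "is_expectation E \<Longrightarrow> mean (Abs_law E) = E"
  by (simp add: Abs_law_inverse)

lemma is_expectation_mean: "is_expectation (mean \<mu>)"
  using mean[of \<mu>] by simp

lemma mean_add: "mean \<mu> (\<lambda>x. f x + g x) = mean \<mu> f + mean \<mu> g"
  and mean_cmult: "mean \<mu> (\<lambda>x. c * f x) = c * mean \<mu> f"
  using is_expectation_mean[of \<mu>] unfolding is_expectation_def by blast+

lemma mean_mono: "(\<And>x. 0 \<le> x \<Longrightarrow> f x \<le> g x) \<Longrightarrow> mean \<mu> f \<le> mean \<mu> g"
  using is_expectation_mean[of \<mu>] unfolding is_expectation_def by blast

lemma mean_const [simp]: "mean \<mu> (\<lambda>_. c) = c"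
  using is_expectation_mean[of \<mu>] mean_cmult[of \<mu> c "\<lambda>_. 1"] unfolding is_expectation_def by simp

lemma mean_multc: "mean \<mu> (\<lambda>x. f x * c) = mean \<mu> f * c"
  using mean_cmult[of \<mu> c f] by (simp add: mult.commute)

lemma mean_diff: "mean \<mu> (\<lambda>x. f x - g x) = mean \<mu> f - mean \<mu> g"
  using mean_add[of \<mu> f "\<lambda>x. - 1 * g x"] mean_cmult[of \<mu> "-1" g] by simp

lemma mean_cong: "(\<And>x. 0 \<le> x \<Longrightarrow> f x = g x) \<Longrightarrow> mean \<mu> f = mean \<mu> g"
  by (intro antisym mean_mono) simp_all

lemma mean_nonneg: "(\<And>x. 0 \<le> x \<Longrightarrow> 0 \<le> f x) \<Longrightarrow> 0 \<le> mean \<mu> f"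
  using mean_mono[of "\<lambda>_. 0" f \<mu>] by simp

lemma mean_mean_mono:
  assumes "\<And>a b. 0 \<le> a \<Longrightarrow> 0 \<le> b \<Longrightarrow> f a b \<le> g a b"
  shows "mean \<mu> (\<lambda>a. mean \<mu> (f a)) \<le> mean \<mu> (\<lambda>a. mean \<mu> (g a))"
  by (rule mean_mono, rule mean_mono, rule assms)

lemma mean_mean_cong:
  assumes "\<And>a b. 0 \<le> a \<Longrightarrow> 0 \<le> b \<Longrightarrow> f a b = g a b"
  shows "mean \<mu> (\<lambda>a. mean \<mu> (f a)) = mean \<mu> (\<lambda>a. mean \<mu> (g a))"
  by (rule mean_cong, rule mean_cong, rule assms)

lemma mean_mean_prod: "mean \<mu> (\<lambda>a. mean \<mu> (\<lambda>b. f a * f b)) = (mean \<mu> f)\<^sup>2"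
  by (simp add: mean_cmult mean_multc power2_eq_square)

lemma mean_mean_sum: "mean \<mu> (\<lambda>a. mean \<mu> (\<lambda>b. f a + f b)) = 2 * mean \<mu> f"
  by (simp add: mean_add)

definition law_minus :: "law \<Rightarrow> law" where
  "law_minus \<mu> = Abs_law (\<lambda>f. mean \<mu> (\<lambda>a. mean \<mu> (\<lambda>b. f ((a + b) / (1 + a * b)))))"

definition law_plus :: "law \<Rightarrow> law" where
  "law_plus \<mu> = Abs_law (\<lambda>f. mean \<mu> (\<lambda>a. mean \<mu> (\<lambda>b. f (a * b))))"

lemma is_expectation_combine:
  assumes "\<And>a b. 0 \<le> a \<Longrightarrow> 0 \<le> b \<Longrightarrow> 0 \<le> h a b"
  shows "is_expectation (\<lambda>f. mean \<mu> (\<lambda>a. mean \<mu> (\<lambda>b. f (h a b))))"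
  unfolding is_expectation_def using assms
  by (auto simp: mean_add mean_cmult intro!: mean_mean_mono)

lemma mean_law_minus: "mean (law_minus \<mu>) f = mean \<mu> (\<lambda>a. mean \<mu> (\<lambda>b. f ((a + b) / (1 + a * b))))"
  unfolding law_minus_def by (subst mean_Abs_law) (simp_all add: is_expectation_combine)

lemma mean_law_plus: "mean (law_plus \<mu>) f = mean \<mu> (\<lambda>a. mean \<mu> (\<lambda>b. f (a * b)))"
  unfolding law_plus_def by (subst mean_Abs_law) (simp_all add: is_expectation_combine)

section \<open>Averages over random sequences of polarization steps\<close>

text \<open>Expectation over \<open>n\<close> independent fair choices between a minus and a plus
  step. The counter \<open>k\<close> records the number of plus steps, because several bounds below
  compare a law with a scale determined by that number.\<close>

primrec avg :: "nat \<Rightarrow> (law \<Rightarrow> nat \<Rightarrow> real) \<Rightarrow> law \<Rightarrow> nat \<Rightarrow> real" where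
  "avg 0 f \<mu> k = f \<mu> k"
| "avg (Suc n) f \<mu> k = (avg n f (law_minus \<mu>) k + avg n f (law_plus \<mu>) (Suc k)) / 2"

lemma avg_mono:
  assumes "\<And>\<nu> j. f \<nu> j \<le> g \<nu> j"
  shows "avg n f \<mu> k \<le> avg n g \<mu> k"
proof (induction n arbitrary: \<mu> k)
  case (Suc n)
  show ?case using Suc[of "law_minus \<mu>" k] Suc[of "law_plus \<mu>" "Suc k"] by simp
qed (simp add: assms)

lemma avg_add: "avg n (\<lambda>\<nu> j. f \<nu> j + g \<nu> j) \<mu> k = avg n f \<mu> k + avg n g \<mu> k"
  by (induction n arbitrary: \<mu> k) (simp_all add: field_simps)

lemma avg_diff: "avg n (\<lambda>\<nu> j. f \<nu> j - g \<nu> j) \<mu> k = avg n f \<mu> k - avg n g \<mu> k"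
proof (induction n arbitrary: \<mu> k)
  case (Suc n)
  show ?case unfolding avg.simps Suc by (simp add: field_simps)
qed simp

lemma avg_cmult: "avg n (\<lambda>\<nu> j. c * f \<nu> j) \<mu> k = c * avg n f \<mu> k"
  by (induction n arbitrary: \<mu> k) (simp_all add: field_simps)

lemma avg_const [simp]: "avg n (\<lambda>\<nu> j. c) \<mu> k = c"
  by (induction n arbitrary: \<mu> k) simp_all

lemma avg_append: "avg (m + n) f \<mu> k = avg m (avg n f) \<mu> k"
  by (induction m arbitrary: \<mu> k) simp_all

lemma avg_shift: "avg n f \<mu> (k + c) = avg n (\<lambda>\<nu> j. f \<nu> (j + c)) \<mu> k"
proof (induction n arbitrary: \<mu> k)
  case (Suc n)
  show ?case using Suc[of "law_plus \<mu>" "Suc k"] Suc[of "law_minus \<mu>" k] by simp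
qed simp

lemma avg_shift0: "avg n (\<lambda>\<nu> _. f \<nu>) \<mu> k = avg n (\<lambda>\<nu> _. f \<nu>) \<mu> 0"
  using avg_shift[of n "\<lambda>\<nu> _. f \<nu>" \<mu> 0 k] by simp

lemma avg_nonneg: "(\<And>\<nu> j. 0 \<le> f \<nu> j) \<Longrightarrow> 0 \<le> avg n f \<mu> k"
  using avg_mono[of "\<lambda>_ _. 0" f n \<mu> k] by simp

lemma avg_le_const: "(\<And>\<nu> j. f \<nu> j \<le> c) \<Longrightarrow> avg n f \<mu> k \<le> c"
  using avg_mono[of f "\<lambda>_ _. c" n \<mu> k] by simp

text \<open>The sequence of \<open>n\<close> minus steps has weight \<open>1 / 2 ^ n\<close>, and
  all other sequences contribute nonnegatively.\<close>

lemma avg_ge_all_minus: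
  assumes "\<And>\<nu> j. 0 \<le> f \<nu> j"
  shows "f ((law_minus ^^ n) \<mu>) k / 2 ^ n \<le> avg n f \<mu> k"
proof (induction n arbitrary: \<mu>)
  case (Suc n)
  have "0 \<le> avg n f (law_plus \<mu>) (Suc k)" by (intro avg_nonneg assms)
  with Suc[of "law_minus \<mu>"] show ?case by (simp add: funpow_swap1)
qed simp

section \<open>Cross entropy and mean hyperbolic tangent\<close>

definition cross_entropy :: "law \<Rightarrow> real" where
  "cross_entropy \<mu> = mean \<mu> (\<lambda>l. log 2 (1 + l))"

lemma cross_entropy_nonneg: "0 \<le> cross_entropy \<mu>"
  unfolding cross_entropy_def by (rule mean_nonneg) auto

lemma cross_entropy_conservation:
  "cross_entropy (law_minus \<mu>) + cross_entropy (law_plus \<mu>) = 2 * cross_entropy \<mu>"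
proof -
  have "log 2 (1 + (a + b) / (1 + a * b)) + log 2 (1 + a * b) = log 2 (1 + a) + log 2 (1 + b)"
    if "0 \<le> a" "0 \<le> b" for a b :: real
  proof -
    have "0 < 1 + a * b" using that by (simp add: add_pos_nonneg)
    moreover have "0 < 1 + (a + b) / (1 + a * b)" using that by (simp add: add_pos_nonneg)
    ultimately have "log 2 (1 + (a + b) / (1 + a * b)) + log 2 (1 + a * b)
        = log 2 ((1 + (a + b) / (1 + a * b)) * (1 + a * b))"
      by (simp add: log_mult)
    also have "(1 + (a + b) / (1 + a * b)) * (1 + a * b) = (1 + a) * (1 + b)"
      using \<open>0 < 1 + a * b\<close> by (simp add: field_simps)
    finally show ?thesis using that by (simp add: log_mult)
  qed
  then have "mean \<mu> (\<lambda>a. mean \<mu> (\<lambda>b. log 2 (1 + (a + b) / (1 + a * b)) + log 2 (1 + a * b)))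
      = mean \<mu> (\<lambda>a. mean \<mu> (\<lambda>b. log 2 (1 + a) + log 2 (1 + b)))"
    by (rule mean_mean_cong)
  then show ?thesis
    unfolding cross_entropy_def mean_law_minus mean_law_plus mean_mean_sum by (simp add: mean_add)
qed

lemma avg_cross_entropy: "avg n (\<lambda>\<nu> _. cross_entropy \<nu>) \<mu> k = cross_entropy \<mu>"
  by (induction n arbitrary: \<mu> k) (simp_all add: cross_entropy_conservation)

text \<open>For \<open>l = exp (- t)\<close> the integrand is \<open>tanh (t / 2)\<close>, the
  coordinate in which the minus combination becomes a product.\<close>

definition mean_tanh :: "law \<Rightarrow> real" where
  "mean_tanh \<mu> = mean \<mu> (\<lambda>l. (1 - l) / (1 + l))"

lemma mean_tanh_minus: "mean_tanh (law_minus \<mu>) = (mean_tanh \<mu>)\<^sup>2"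
proof -
  have "(1 - (a + b) / (1 + a * b)) / (1 + (a + b) / (1 + a * b)) = (1 - a) / (1 + a) * ((1 - b) / (1 + b))"
    if "0 \<le> a" "0 \<le> b" for a b :: real
  proof -
    have p: "0 < 1 + a * b" "0 < 1 + a" "0 < 1 + b" using that by (simp_all add: add_pos_nonneg)
    have "1 - (a + b) / (1 + a * b) = (1 - a) * (1 - b) / (1 + a * b)"
      "1 + (a + b) / (1 + a * b) = (1 + a) * (1 + b) / (1 + a * b)"
      using p by (simp_all add: field_simps)
    with p show ?thesis by simp
  qed
  then show ?thesis
    unfolding mean_tanh_def mean_law_minus mean_mean_prod[symmetric] by (rule mean_mean_cong)
qed

lemma mean_tanh_minus_power: "mean_tanh ((law_minus ^^ n) \<mu>) = mean_tanh \<mu> ^ (2 ^ n)"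
  by (induction n) (simp_all add: mean_tanh_minus power_mult[symmetric] mult.commute)

text \<open>The tangent bound \<open>ln u \<le> u - 1\<close> at \<open>u = 2 / (1 + l)\<close>,
  where \<open>u - 1 = (1 - l) / (1 + l)\<close>.\<close>

lemma cross_entropy_ge_mean_tanh: "1 - mean_tanh \<mu> / ln 2 \<le> cross_entropy \<mu>"
proof -
  have "1 - (1 - l) / (1 + l) * inverse (ln 2) \<le> log 2 (1 + l)" if "0 \<le> l" for l :: real
  proof -
    have "ln (2 / (1 + l)) \<le> 2 / (1 + l) - 1" using that by (intro ln_le_minus_one) simp
    also have "\<dots> = (1 - l) / (1 + l)" using that by (simp add: field_simps)
    finally have "ln 2 - ln (1 + l) \<le> (1 - l) / (1 + l)" using that by (simp add: ln_div)
    then have "(ln 2 - ln (1 + l)) * inverse (ln 2) \<le> (1 - l) / (1 + l) * inverse (ln 2)"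
      by (rule mult_right_mono) simp
    moreover have "(ln 2 - ln (1 + l)) * inverse (ln 2) = 1 - log 2 (1 + l)"
      by (simp add: log_def divide_inverse left_diff_distrib)
    ultimately show ?thesis by linarith
  qed
  then have "mean \<mu> (\<lambda>l. 1 - (1 - l) / (1 + l) * inverse (ln 2)) \<le> cross_entropy \<mu>"
    unfolding cross_entropy_def by (rule mean_mono)
  then show ?thesis by (simp only: mean_diff mean_multc mean_const mean_tanh_def divide_inverse)
qed

section \<open>Polarization\<close>

text \<open>With \<open>s = a + b\<close> the fractions \<open>a / s\<close> and
  \<open>b / s\<close> lie in [0, 1], where \<open>t \<le> t powr p\<close>. Scaling by
  \<open>s powr p\<close> and adding gives the claim.\<close>

lemma powr_add_le:
  fixes a b p :: real
  assumes "0 \<le> a" "0 \<le> b" "0 < p" "p \<le> 1"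
  shows "(a + b) powr p \<le> a powr p + b powr p"
proof (cases "a + b = 0")
  case False
  define s where "s = a + b"
  have s: "0 < s" using False assms by (simp add: s_def)
  have le: "x / s * s powr p \<le> x powr p" if "0 \<le> x" "x \<le> s" for x
  proof -
    have "x / s \<le> (x / s) powr p"
      using powr_mono'[of p 1 "x / s"] that s assms by simp
    then have "x / s * s powr p \<le> (x / s) powr p * s powr p" by (rule mult_right_mono) simp
    also have "\<dots> = x powr p" using s by (simp add: powr_mult[symmetric])
    finally show ?thesis .
  qed
  have "s powr p = a / s * s powr p + b / s * s powr p"
    using s by (simp add: s_def add_divide_distrib[symmetric] distrib_right[symmetric])
  also have "\<dots> \<le> a powr p + b powr p"
    using le[of a] le[of b] assms by (simp add: s_def)
  finally show ?thesis by (simp add: s_def)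
qed (use assms in auto)

lemma combine_minus_le:
  fixes a b :: real
  assumes "0 \<le> a" "0 \<le> b"
  shows "0 \<le> (a + b) / (1 + a * b)" "(a + b) / (1 + a * b) \<le> a + b"
proof -
  show "(a + b) / (1 + a * b) \<le> a + b"
    using divide_left_mono[of 1 "1 + a * b" "a + b"] assms by (simp add: add_pos_nonneg)
qed (use assms in simp)

lemma powr_combine_minus_le:
  fixes a b p :: real
  assumes "0 \<le> a" "0 \<le> b" "0 < p" "p \<le> 1"
  shows "((a + b) / (1 + a * b)) powr p \<le> a powr p + b powr p"
  using powr_mono2[of p "(a + b) / (1 + a * b)" "a + b"] combine_minus_le[of a b]
    powr_add_le[of a b p] assms by linarith

text \<open>Jensen's inequality for a concave power: average the weighted arithmetic-geometric
  inequality \<open>f x powr p * b powr (1 - p) \<le> p * f x + (1 - p) * b\<close>, with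
  \<open>b\<close> the mean of \<open>f\<close>.\<close>

lemma mean_powr_le:
  assumes "\<And>x. 0 \<le> x \<Longrightarrow> 0 \<le> f x" "0 < p" "p < 1"
  shows "mean \<mu> (\<lambda>x. f x powr p) \<le> mean \<mu> f powr p"
proof -
  let ?m = "mean \<mu> (\<lambda>x. f x powr p)" and ?c = "mean \<mu> f"
  have c: "0 \<le> ?c" by (rule mean_nonneg) (rule assms(1))
  have le: "?m \<le> b powr p" if "?c \<le> b" "0 < b" for b
  proof -
    have "f x powr p * b powr (1 - p) \<le> p * f x + (1 - p) * b" if "0 \<le> x" for x
      using Youngs_inequality_0[of p "1 - p" "f x" b] assms \<open>0 < b\<close> that
      by (cases "f x = 0") (fastforce simp: less_le)+
    then have "mean \<mu> (\<lambda>x. f x powr p * b powr (1 - p)) \<le> mean \<mu> (\<lambda>x. p * f x + (1 - p) * b)"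
      by (rule mean_mono)
    then have "?m * b powr (1 - p) \<le> p * ?c + (1 - p) * b"
      by (simp add: mean_multc mean_add mean_cmult)
    also have "\<dots> \<le> p * b + (1 - p) * b" using that assms by simp
    also have "\<dots> = b powr p * b powr (1 - p)"
      using that by (simp add: powr_add[symmetric] algebra_simps)
    finally show ?thesis using that by simp
  qed
  show ?thesis
  proof (cases "?c = 0")
    case True
    have "?m \<le> 0"
    proof (rule ccontr)
      assume "\<not> ?m \<le> 0"
      then have m: "0 < ?m" by simp
      \<comment> \<open>This \<open>b\<close> is chosen so that the bound reads
        \<open>?m \<le> ?m / 2\<close>.\<close>
      then have "?m \<le> ((?m / 2) powr (1 / p)) powr p" using True by (intro le) auto
      also have "\<dots> = ?m / 2" using m assms by (simp add: powr_powr)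
      finally show False using m by simp
    qed
    then show ?thesis using True by simp
  qed (use le[of ?c] c in simp)
qed

section \<open>Capped moments on a growing scale\<close>

text \<open>Values \<open>l > 2 powr z\<close> count only through their probability, which is at
  most \<open>cross_entropy \<mu> / z\<close> by Markov's inequality for
  \<open>log 2 (1 + l)\<close>.\<close>

definition capped_moment :: "real \<Rightarrow> law \<Rightarrow> real" where
  "capped_moment z \<mu> = mean \<mu> (\<lambda>l. min (l powr (1 / z)) 2)"

lemma capped_moment_nonneg: "0 \<le> capped_moment z \<mu>"
  unfolding capped_moment_def by (rule mean_nonneg) simp

text \<open>Subadditivity of \<open>l powr (1 / z)\<close> survives the cap, since
  \<open>min (s + t) 2 \<le> min s 2 + min t 2\<close> for nonnegative \<open>s\<close> and
  \<open>t\<close>.\<close>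

lemma capped_moment_minus:
  assumes "1 \<le> z"
  shows "capped_moment z (law_minus \<mu>) \<le> 2 * capped_moment z \<mu>"
proof -
  have "min (((a + b) / (1 + a * b)) powr (1 / z)) 2 \<le> min (a powr (1 / z)) 2 + min (b powr (1 / z)) 2"
    if "0 \<le> a" "0 \<le> b" for a b :: real
    using powr_combine_minus_le[of a b "1 / z"] that assms powr_ge_zero[of a "1 / z"]
      powr_ge_zero[of b "1 / z"] by (simp add: min_def del: powr_ge_zero)
  then show ?thesis
    unfolding capped_moment_def mean_law_minus mean_mean_sum[symmetric] by (rule mean_mean_mono)
qed

text \<open>Below the cap the new integrand factors into 3/4-th powers of the old ones; independence
  squares the mean of one factor, and Jensen's inequality turns it into the power 3/2. If one factor
  exceeds the cap, the value 2 is paid by \<open>?w\<close>. The factor 4/3 thus enlarges the scale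
  while keeping an exponent above 1.\<close>

lemma capped_moment_plus:
  assumes "1 \<le> z"
  shows "capped_moment (4 / 3 * z) (law_plus \<mu>)
    \<le> capped_moment z \<mu> powr (3 / 2) + 4 * (cross_entropy \<mu> / z)"
proof -
  let ?u = "\<lambda>l. min (l powr (1 / z)) 2 powr (3 / 4)" and ?w = "\<lambda>l. 2 / z * log 2 (1 + l)"
  have big: "2 \<le> ?w l" if "0 \<le> l" "2 < l powr (1 / z)" for l
  proof -
    have "l \<noteq> 0" using that by auto
    have "2 powr z \<le> (l powr (1 / z)) powr z" using that assms by (intro powr_mono2) auto
    also have "\<dots> = l" using that assms \<open>l \<noteq> 0\<close> by (simp add: powr_powr)
    finally have "z \<le> log 2 (1 + l)" using that by (simp add: le_log_iff)
    then show ?thesis using assms by (simp add: field_simps)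
  qed
  have w: "0 \<le> ?w l" if "0 \<le> l" for l using that assms by simp
  have "min ((a * b) powr (1 / (4 / 3 * z))) 2 \<le> ?u a * ?u b + (?w a + ?w b)"
    if "0 \<le> a" "0 \<le> b" for a b
  proof (cases "2 < a powr (1 / z) \<or> 2 < b powr (1 / z)")
    case True
    then have "2 \<le> ?w a + ?w b" using big[of a] big[of b] w[of a] w[of b] that by fastforce
    moreover have "0 \<le> ?u a * ?u b" "min ((a * b) powr (1 / (4 / 3 * z))) 2 \<le> 2" by simp_all
    ultimately show ?thesis by linarith
  next
    case False
    then have "?u a * ?u b = (a * b) powr (1 / (4 / 3 * z))"
      by (simp add: powr_powr powr_mult mult.commute)
    then show ?thesis using w[of a] w[of b] that by linarith
  qed
  then have "capped_moment (4 / 3 * z) (law_plus \<mu>)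
      \<le> mean \<mu> (\<lambda>a. mean \<mu> (\<lambda>b. ?u a * ?u b + (?w a + ?w b)))"
    unfolding capped_moment_def mean_law_plus by (rule mean_mean_mono)
  also have "\<dots> = (mean \<mu> ?u)\<^sup>2 + 2 * mean \<mu> ?w"
    unfolding mean_mean_prod[symmetric] mean_mean_sum[symmetric] by (simp only: mean_add)
  also have "2 * mean \<mu> ?w = 4 * (cross_entropy \<mu> / z)"
    unfolding cross_entropy_def mean_cmult by simp
  also have "(mean \<mu> ?u)\<^sup>2 \<le> (capped_moment z \<mu> powr (3 / 4))\<^sup>2"
    unfolding capped_moment_def
    by (intro power_mono mean_powr_le) (auto intro: mean_nonneg)
  also have "\<dots> = capped_moment z \<mu> powr (3 / 2)"
    using capped_moment_nonneg[of z \<mu>] by (simp add: power2_eq_square powr_add[symmetric])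
  finally show ?thesis by simp
qed

text \<open>A supermartingale for the scale growing at plus steps, as long as the capped moment is at most \<open>1/16\<close>.\<close>

definition scale_potential :: "real \<Rightarrow> law \<Rightarrow> real" where
  "scale_potential z \<mu> = sqrt (capped_moment z \<mu>) + 16 * sqrt (cross_entropy \<mu> / z)"

text \<open>The square root of the capped moment grows at a minus step by at most
  \<open>sqrt 2 \<le> 3 / 2\<close>. At a plus step it falls to half, since
  \<open>Z powr (3 / 2) \<le> Z / 4\<close> for \<open>Z \<le> 1 / 16\<close>, plus an error
  \<open>2 * c\<close>. As 3/2 + 1/2 = 2, only the error remains. The second summand falls from
  \<open>32 * c\<close> to at most \<open>30 * c\<close>, because the larger scale gains a factor
  3/4 at the plus step; the weight 16 is chosen to pay exactly this error.\<close>

lemma scale_potential_step: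
  assumes z: "1 \<le> z" and small: "capped_moment z \<mu> \<le> 1 / 16"
  shows "scale_potential z (law_minus \<mu>) + scale_potential (4 / 3 * z) (law_plus \<mu>)
    \<le> 2 * scale_potential z \<mu>"
proof -
  let ?Z = "capped_moment z \<mu>"
  define a b c where "a = sqrt (cross_entropy (law_minus \<mu>) / z)"
    and "b = sqrt (cross_entropy (law_plus \<mu>) / z)" and "c = sqrt (cross_entropy \<mu> / z)"
  have nn: "0 \<le> a" "0 \<le> b" "0 \<le> c"
    using z cross_entropy_nonneg by (simp_all add: a_def b_def c_def)
  have "a\<^sup>2 + b\<^sup>2 = 2 * c\<^sup>2"
    using z cross_entropy_nonneg cross_entropy_conservation[of \<mu>]
    by (simp add: a_def b_def c_def add_divide_distrib[symmetric])
  have 1: "sqrt (capped_moment z (law_minus \<mu>)) \<le> 3 / 2 * sqrt ?Z"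
  proof -
    have "capped_moment z (law_minus \<mu>) \<le> (3 / 2)\<^sup>2 * ?Z"
      using capped_moment_minus[OF z, of \<mu>] capped_moment_nonneg[of z \<mu>] by (simp add: power2_eq_square)
    then have "sqrt (capped_moment z (law_minus \<mu>)) \<le> sqrt ((3 / 2)\<^sup>2 * ?Z)"
      by (rule real_sqrt_le_mono)
    then show ?thesis by (simp only: real_sqrt_mult real_sqrt_abs)
  qed
  have 2: "sqrt (capped_moment (4 / 3 * z) (law_plus \<mu>)) \<le> sqrt ?Z / 2 + 2 * c"
  proof -
    have "?Z powr (3 / 2) = ?Z * ?Z powr (1 / 2)"
    proof (cases "?Z = 0")
      case False
      then show ?thesis using capped_moment_nonneg[of z \<mu>] powr_add[of ?Z 1 "1 / 2"] by simp
    qed simp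
    also have "\<dots> \<le> ?Z * (1 / 16) powr (1 / 2)"
      using small capped_moment_nonneg[of z \<mu>] by (intro mult_left_mono powr_mono2) auto
    also have "(1 / 16 :: real) powr (1 / 2) = 1 / 4"
      by (simp add: powr_half_sqrt real_sqrt_divide)
    finally have "capped_moment (4 / 3 * z) (law_plus \<mu>) \<le> ?Z / 4 + 4 * (cross_entropy \<mu> / z)"
      using capped_moment_plus[OF z, of \<mu>] by simp
    also have "\<dots> = (sqrt ?Z / 2)\<^sup>2 + (2 * c)\<^sup>2"
      using capped_moment_nonneg[of z \<mu>] cross_entropy_nonneg[of \<mu>] z
      by (simp add: c_def power_divide power_mult_distrib)
    finally have "sqrt (capped_moment (4 / 3 * z) (law_plus \<mu>)) \<le> sqrt ((sqrt ?Z / 2)\<^sup>2 + (2 * c)\<^sup>2)"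
      by (rule real_sqrt_le_mono)
    also have "\<dots> \<le> sqrt ?Z / 2 + 2 * c"
      using sqrt_sum_squares_le_sum[of "sqrt ?Z / 2" "2 * c"] nn capped_moment_nonneg[of z \<mu>] by simp
    finally show ?thesis .
  qed
  define t where "t = sqrt (3 / 4)"
  have t: "t\<^sup>2 = 3 / 4" by (simp add: t_def)
  have 3: "sqrt (cross_entropy (law_plus \<mu>) / (4 / 3 * z)) = t * b"
    unfolding b_def t_def real_sqrt_mult[symmetric] by (simp add: field_simps)
  \<comment> \<open>Lagrange's identity, which yields the Cauchy-Schwarz bound for
    \<open>a + t * b\<close>.\<close>
  have "(a + t * b)\<^sup>2 + (t * a - b)\<^sup>2 = (1 + t\<^sup>2) * (a\<^sup>2 + b\<^sup>2)"
    by algebra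
  also have "\<dots> = 7 / 2 * c\<^sup>2" unfolding t \<open>a\<^sup>2 + b\<^sup>2 = 2 * c\<^sup>2\<close> by simp
  finally have "(a + t * b)\<^sup>2 \<le> 7 / 2 * c\<^sup>2"
    using zero_le_power2[of "t * a - b"] by linarith
  also have "\<dots> \<le> (15 / 8 * c)\<^sup>2" by (simp add: power_mult_distrib power_divide)
  finally have "a + t * b \<le> 15 / 8 * c" by (rule power2_le_imp_le) (use nn in simp)
  then have "16 * a + 16 * (t * b) \<le> 30 * c" by simp
  moreover have "scale_potential z (law_minus \<mu>) \<le> 3 / 2 * sqrt ?Z + 16 * a"
    "scale_potential (4 / 3 * z) (law_plus \<mu>) \<le> sqrt ?Z / 2 + 2 * c + 16 * (t * b)"
    unfolding scale_potential_def 3 using 1 2 by (simp_all add: a_def)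
  moreover have "scale_potential z \<mu> = sqrt ?Z + 16 * c" by (simp add: scale_potential_def c_def)
  ultimately show ?thesis by simp
qed

text \<open>Optional stopping: the potential is a supermartingale as long as the capped moment is at
  most \<zeta>. Once the moment exceeds \<zeta>, the right-hand side is at least 1 and bounds any
  probability.\<close>

lemma avg_capped_moment_large:
  assumes "1 \<le> z" "0 < \<zeta>" "\<zeta> \<le> 1 / 16"
  shows "avg n (\<lambda>\<nu> j. of_bool (\<zeta> < capped_moment (z * (4 / 3) ^ j) \<nu>)) \<mu> k
    \<le> scale_potential (z * (4 / 3) ^ k) \<mu> / sqrt \<zeta>"
proof (induction n arbitrary: \<mu> k)
  have nonneg: "0 \<le> sqrt (cross_entropy \<mu> / (z * (4 / 3) ^ k))" for \<mu> k
    using assms cross_entropy_nonneg by simp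
  have large: "1 \<le> scale_potential (z * (4 / 3) ^ k) \<mu> / sqrt \<zeta>"
    if "\<zeta> < capped_moment (z * (4 / 3) ^ k) \<mu>" for \<mu> k
  proof -
    have "sqrt \<zeta> \<le> sqrt (capped_moment (z * (4 / 3) ^ k) \<mu>)" using that by simp
    also have "\<dots> \<le> scale_potential (z * (4 / 3) ^ k) \<mu>"
      unfolding scale_potential_def using nonneg[of \<mu> k] by simp
    finally show ?thesis using assms by simp
  qed
  have pos: "0 \<le> scale_potential (z * (4 / 3) ^ k) \<mu> / sqrt \<zeta>" for \<mu> k
    using assms nonneg[of \<mu> k] capped_moment_nonneg
    by (auto simp: scale_potential_def intro!: divide_nonneg_nonneg add_nonneg_nonneg)
  {
    case 0
    show ?case using large[of k \<mu>] pos[of k \<mu>] by auto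
  next
    case (Suc n)
    show ?case
    proof (cases "\<zeta> < capped_moment (z * (4 / 3) ^ k) \<mu>")
      case True
      have "avg (Suc n) (\<lambda>\<nu> j. of_bool (\<zeta> < capped_moment (z * (4 / 3) ^ j) \<nu>)) \<mu> k \<le> 1"
        by (rule avg_le_const) simp
      then show ?thesis using large[OF True] by linarith
    next
      case False
      have "1 \<le> z * (4 / 3) ^ k"
        using assms mult_mono[of 1 z 1 "(4 / 3) ^ k"] by (simp add: one_le_power)
      then have "scale_potential (z * (4 / 3) ^ k) (law_minus \<mu>)
          + scale_potential (4 / 3 * (z * (4 / 3) ^ k)) (law_plus \<mu>) \<le> 2 * scale_potential (z * (4 / 3) ^ k) \<mu>"
        using False assms by (intro scale_potential_step) auto
      then have "(scale_potential (z * (4 / 3) ^ k) (law_minus \<mu>)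
          + scale_potential (z * (4 / 3) ^ Suc k) (law_plus \<mu>)) / sqrt \<zeta>
          \<le> 2 * scale_potential (z * (4 / 3) ^ k) \<mu> / sqrt \<zeta>"
        using assms by (intro divide_right_mono) (simp_all add: mult_ac)
      then show ?thesis
        using Suc[of "law_minus \<mu>" k] Suc[of "law_plus \<mu>" "Suc k"]
        by (simp add: add_divide_distrib)
    qed
  }
qed

text \<open>One step multiplies the average by (1 + 3/4) / 2. Markov's inequality for this inverse
  scale later shows that the scale is rarely small.\<close>

lemma avg_inverse_scale: "avg n (\<lambda>\<nu> j. (3 / 4) ^ j) \<mu> k = (7 / 8) ^ n * (3 / 4) ^ k"
proof (induction n arbitrary: \<mu> k)
  case (Suc n)
  show ?case unfolding avg.simps Suc by (simp add: field_simps)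
qed simp

section \<open>Doubly exponential decay of moments\<close>

definition moment :: "real \<Rightarrow> law \<Rightarrow> real" where
  "moment \<theta> \<mu> = mean \<mu> (\<lambda>l. l powr \<theta>)"

lemma moment_nonneg: "0 \<le> moment \<theta> \<mu>"
  unfolding moment_def by (rule mean_nonneg) simp

lemma moment_plus: "moment \<theta> (law_plus \<mu>) = (moment \<theta> \<mu>)\<^sup>2"
  unfolding moment_def mean_law_plus mean_mean_prod[symmetric] by (simp only: powr_mult)

lemma moment_minus:
  assumes "0 < \<theta>" "\<theta> \<le> 1"
  shows "moment \<theta> (law_minus \<mu>) \<le> 2 * moment \<theta> \<mu>"
  unfolding moment_def mean_law_minus mean_mean_sum[symmetric]
  using assms by (intro mean_mean_mono powr_combine_minus_le)

text \<open>Subadditivity gives \<open>\<theta> * ln (1 + l) \<le> ln (1 + l powr \<theta>) \<le> l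
  powr \<theta>\<close>.\<close>

lemma cross_entropy_le_moment:
  assumes "0 < \<theta>" "\<theta> \<le> 1"
  shows "cross_entropy \<mu> \<le> moment \<theta> \<mu> / (\<theta> * ln 2)"
proof -
  have "log 2 (1 + l) \<le> l powr \<theta> * inverse (\<theta> * ln 2)" if "0 \<le> l" for l
  proof -
    have "\<theta> * ln (1 + l) = ln ((1 + l) powr \<theta>)" using that by (simp add: ln_powr)
    also have "\<dots> \<le> ln (1 + l powr \<theta>)"
      using powr_add_le[of 1 l \<theta>] that assms by (intro ln_mono) (auto simp: add_pos_nonneg)
    also have "\<dots> \<le> l powr \<theta>" by (rule ln_add_one_self_le_self) simp
    finally show ?thesis using assms by (simp add: log_def field_simps)
  qed
  then show ?thesis
    unfolding cross_entropy_def moment_def divide_inverse mean_multc[symmetric] by (rule mean_mono)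
qed

text \<open>Here \<open>x\<close> is the slack in the exponent relative to \<open>2 ^ k\<close>,
  with \<open>k\<close> the number of plus steps. A plus step squares the moment and doubles the
  slack; a minus step costs at most 1. Hence \<open>3 / x\<close> acts as a supermartingale for
  \<open>x > 3\<close>, and for \<open>x \<le> 3\<close> it is a trivial bound.\<close>

lemma avg_moment_large:
  assumes \<theta>: "0 < \<theta>" "\<theta> \<le> 1"
  shows "0 < x \<Longrightarrow> moment \<theta> \<mu> \<le> 2 powr - (2 ^ k + x) \<Longrightarrow>
    avg n (\<lambda>\<nu> j. of_bool (2 powr - (2 ^ j) < moment \<theta> \<nu>)) \<mu> k \<le> 3 / x"
proof (induction n arbitrary: \<mu> k x)
  case 0
  have "2 powr - (2 ^ k + x) \<le> (2::real) powr - (2 ^ k)" using 0 by (intro powr_mono) auto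
  then have "\<not> 2 powr - (2 ^ k) < moment \<theta> \<mu>" using 0 by linarith
  then show ?case using 0 by simp
next
  case (Suc n)
  let ?f = "\<lambda>\<nu> j. of_bool (2 powr - (2 ^ j) < moment \<theta> \<nu>) :: real"
  show ?case
  proof (cases "x \<le> 3")
    case True
    have "avg (Suc n) ?f \<mu> k \<le> 1" by (rule avg_le_const) simp
    also have "1 \<le> 3 / x" using True Suc by simp
    finally show ?thesis .
  next
    case False
    have "moment \<theta> (law_plus \<mu>) \<le> (2 powr - (2 ^ k + x))\<^sup>2"
      unfolding moment_plus using Suc.prems moment_nonneg by (intro power_mono)
    also have "\<dots> = 2 powr - (2 ^ Suc k + 2 * x)"
      by (simp add: power2_eq_square powr_add[symmetric] algebra_simps)
    finally have p: "avg n ?f (law_plus \<mu>) (Suc k) \<le> 3 / (2 * x)" using Suc by simp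
    have "moment \<theta> (law_minus \<mu>) \<le> 2 powr 1 * 2 powr - (2 ^ k + x)"
      using moment_minus[OF \<theta>, of \<mu>] Suc.prems by simp
    also have "\<dots> = 2 powr - (2 ^ k + (x - 1))"
      unfolding powr_add[symmetric] by (simp add: algebra_simps)
    finally have m: "avg n ?f (law_minus \<mu>) k \<le> 3 / (x - 1)" using False by (intro Suc.IH) simp_all
    have "3 / (2 * x) + 3 / (x - 1) \<le> 6 / x" using False by (simp add: field_simps)
    then show ?thesis using p m by (simp add: field_simps)
  qed
qed

lemma avg_plus_count_variance: "avg n (\<lambda>\<nu> j. (2 * real j - c)\<^sup>2) \<mu> k = (2 * real k + real n - c)\<^sup>2 + real n"
proof (induction n arbitrary: \<mu> k)
  case (Suc n)
  show ?case unfolding avg.simps Suc by (simp add: power2_eq_square field_simps)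
qed simp

text \<open>Chebyshev's inequality: twice the number of plus steps has mean \<open>n\<close> and
  variance \<open>n\<close>.\<close>

lemma avg_plus_count_small:
  assumes "0 < t"
  shows "avg n (\<lambda>\<nu> j. of_bool (real j < real n / 2 - t)) \<mu> 0 \<le> real n / (4 * t\<^sup>2)"
proof -
  have "of_bool (real j < real n / 2 - t) \<le> 1 / (4 * t\<^sup>2) * (2 * real j - real n)\<^sup>2" for j
  proof (cases "real j < real n / 2 - t")
    case True
    then have "(2 * t)\<^sup>2 \<le> (real n - 2 * real j)\<^sup>2" using assms by (intro power_mono) auto
    then have "4 * t\<^sup>2 \<le> (2 * real j - real n)\<^sup>2" by (simp add: power2_commute power_mult_distrib)
    then show ?thesis using True assms by (simp add: field_simps)
  qed simp
  then have "avg n (\<lambda>\<nu> j. of_bool (real j < real n / 2 - t)) \<mu> 0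
      \<le> avg n (\<lambda>\<nu> j. 1 / (4 * t\<^sup>2) * (2 * real j - real n)\<^sup>2) \<mu> 0"
    by (intro avg_mono)
  then show ?thesis by (simp only: avg_cmult avg_plus_count_variance) simp
qed

section \<open>Excess moments and removal of the cap\<close>

definition excess_moment :: "real \<Rightarrow> law \<Rightarrow> real" where
  "excess_moment \<rho> \<mu> = mean \<mu> (\<lambda>l. (1 + l) powr \<rho>) - 1"

lemma excess_moment_nonneg: "0 < \<rho> \<Longrightarrow> 0 \<le> excess_moment \<rho> \<mu>"
  using mean_mono[of "\<lambda>_. 1" "\<lambda>l. (1 + l) powr \<rho>" \<mu>]
  by (simp add: excess_moment_def ge_one_powr_ge_zero)

text \<open>The two new values \<open>?A\<close> and \<open>?B\<close> of
  \<open>(1 + l) powr \<rho>\<close> have the same product as the two old ones, and both are at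
  least 1, so that \<open>?A + ?B \<le> ?A * ?B + 1\<close>.\<close>

lemma excess_moment_step:
  assumes "0 < \<rho>"
  shows "excess_moment \<rho> (law_minus \<mu>) + excess_moment \<rho> (law_plus \<mu>)
    \<le> 2 * excess_moment \<rho> \<mu> + (excess_moment \<rho> \<mu>)\<^sup>2"
proof -
  let ?m = "mean \<mu> (\<lambda>l. (1 + l) powr \<rho>)"
  have "(1 + (a + b) / (1 + a * b)) powr \<rho> + (1 + a * b) powr \<rho> \<le> (1 + a) powr \<rho> * (1 + b) powr \<rho> + 1"
    if "0 \<le> a" "0 \<le> b" for a b :: real
  proof -
    have p: "0 < 1 + a * b" using that by (simp add: add_pos_nonneg)
    let ?A = "(1 + (a + b) / (1 + a * b)) powr \<rho>" and ?B = "(1 + a * b) powr \<rho>"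
    have "?A * ?B = ((1 + (a + b) / (1 + a * b)) * (1 + a * b)) powr \<rho>" by (simp add: powr_mult)
    also have "(1 + (a + b) / (1 + a * b)) * (1 + a * b) = (1 + a) * (1 + b)"
      using p by (simp add: field_simps)
    finally have "?A * ?B = (1 + a) powr \<rho> * (1 + b) powr \<rho>" by (simp add: powr_mult)
    moreover have "1 \<le> ?A" "1 \<le> ?B" using that assms combine_minus_le[of a b]
      by (auto intro!: ge_one_powr_ge_zero)
    then have "0 \<le> (?A - 1) * (?B - 1)" by simp
    then have "?A + ?B \<le> ?A * ?B + 1" by (simp add: algebra_simps)
    ultimately show ?thesis by simp
  qed
  then have "mean \<mu> (\<lambda>a. mean \<mu> (\<lambda>b. (1 + (a + b) / (1 + a * b)) powr \<rho> + (1 + a * b) powr \<rho>))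
    \<le> mean \<mu> (\<lambda>a. mean \<mu> (\<lambda>b. (1 + a) powr \<rho> * (1 + b) powr \<rho> + 1))"
    by (rule mean_mean_mono)
  then have "mean (law_minus \<mu>) (\<lambda>l. (1 + l) powr \<rho>) + mean (law_plus \<mu>) (\<lambda>l. (1 + l) powr \<rho>) \<le> ?m\<^sup>2 + 1"
    unfolding mean_law_minus mean_law_plus mean_mean_prod[symmetric] by (simp add: mean_add)
  then show ?thesis
    unfolding excess_moment_def by (simp add: power2_eq_square algebra_simps)
qed

text \<open>The mean excess grows from \<open>v\<close> to at most \<open>v + v\<^sup>2 / 2\<close>
  in one step. If \<open>c * v \<ge> 1\<close> the bound is trivial; otherwise
  \<open>c * v\<^sup>2 / 2 \<le> v / 2\<close>, so each step adds only 1/2 to the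
  coefficient.\<close>

lemma avg_excess_moment_large:
  assumes "0 < \<rho>" "0 < \<kappa>"
  shows "avg n (\<lambda>\<nu> j. of_bool (\<kappa> < excess_moment \<rho> \<nu>)) \<mu> k \<le> (1 / \<kappa> + real n / 2) * excess_moment \<rho> \<mu>"
proof (induction n arbitrary: \<mu> k)
  case 0
  show ?case using excess_moment_nonneg[OF assms(1), of \<mu>] assms by (auto simp: field_simps)
next
  case (Suc n)
  let ?f = "\<lambda>\<nu> j. of_bool (\<kappa> < excess_moment \<rho> \<nu>) :: real"
  define c v where "c = 1 / \<kappa> + real n / 2" and "v = excess_moment \<rho> \<mu>"
  have v: "0 \<le> v" and c: "0 < c"
    using excess_moment_nonneg[OF assms(1)] assms by (simp_all add: v_def c_def add_pos_nonneg)
  have "avg (Suc n) ?f \<mu> k \<le> (c + 1 / 2) * v"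
  proof (cases "1 \<le> c * v")
    case True
    have "avg (Suc n) ?f \<mu> k \<le> 1" by (rule avg_le_const) simp
    also have "1 \<le> (c + 1 / 2) * v" using True v by (simp add: algebra_simps)
    finally show ?thesis .
  next
    case False
    have "avg (Suc n) ?f \<mu> k
        \<le> (c * excess_moment \<rho> (law_minus \<mu>) + c * excess_moment \<rho> (law_plus \<mu>)) / 2"
      unfolding avg.simps c_def by (intro divide_right_mono add_mono Suc) simp
    also have "\<dots> = c * (excess_moment \<rho> (law_minus \<mu>) + excess_moment \<rho> (law_plus \<mu>)) / 2"
      by (simp add: algebra_simps)
    also have "\<dots> \<le> c * (2 * v + v\<^sup>2) / 2"
      using excess_moment_step[OF assms(1), of \<mu>] c by (simp add: v_def)
    also have "\<dots> = c * v + c * v * v / 2" by (simp add: power2_eq_square algebra_simps)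
    also have "c * v * v \<le> 1 * v" using False v by (intro mult_right_mono) auto
    finally show ?thesis by (simp add: algebra_simps)
  qed
  then show ?case by (simp add: c_def v_def field_simps)
qed

text \<open>Above the cap, \<open>u = l powr (1 / z) > 2\<close> satisfies
  \<open>2 * u \<le> u * u = l powr (2 / z) \<le> (1 + l) powr \<rho>\<close>, so the excess moment
  pays for the part cut off by the cap.\<close>

lemma moment_le_capped_moment:
  assumes "1 \<le> z" "2 / z \<le> \<rho>"
  shows "moment (1 / z) \<mu> \<le> capped_moment z \<mu> + excess_moment \<rho> \<mu>"
proof -
  have "l powr (1 / z) \<le> min (l powr (1 / z)) 2 + ((1 + l) powr \<rho> - 1)" if "0 \<le> l" for l
  proof -
    have \<rho>: "0 < \<rho>" using assms by (auto intro: less_le_trans[of 0 "2 / z"])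
    show ?thesis
    proof (cases "l powr (1 / z) \<le> 2")
      case True
      then show ?thesis using that \<rho> by (simp add: ge_one_powr_ge_zero)
    next
      case False
      define u where "u = l powr (1 / z)"
      have "u * u = l powr (2 / z)" by (simp add: u_def powr_add[symmetric])
      also have "\<dots> \<le> (1 + l) powr (2 / z)" using that assms by (intro powr_mono2) auto
      also have "\<dots> \<le> (1 + l) powr \<rho>" using that assms by (intro powr_mono) auto
      finally have "u * u \<le> (1 + l) powr \<rho>" .
      moreover have "2 * u \<le> u * u" using False by (intro mult_right_mono) (auto simp: u_def)
      ultimately have "u \<le> 2 + ((1 + l) powr \<rho> - 1)" using False unfolding u_def by linarith
      then show ?thesis using False by (simp add: u_def[symmetric] min_def)
    qed
  qed
  then have "moment (1 / z) \<mu> \<le> mean \<mu> (\<lambda>l. min (l powr (1 / z)) 2 + ((1 + l) powr \<rho> - 1))"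
    unfolding moment_def by (rule mean_mono)
  then show ?thesis
    unfolding capped_moment_def excess_moment_def by (simp add: mean_add mean_diff)
qed

lemma avg_mono_count:
  assumes "\<And>\<nu> j. j \<le> k + n \<Longrightarrow> f \<nu> j \<le> g \<nu> j"
  shows "avg n f \<mu> k \<le> avg n g \<mu> k"
  using assms
proof (induction n arbitrary: \<mu> k)
  case (Suc n)
  show ?case using Suc.IH[of k "law_minus \<mu>"] Suc.IH[of "Suc k" "law_plus \<mu>"] Suc.prems by simp
qed simp

section \<open>Polarization after a bounded number of steps\<close>

text \<open>Quantitative strict convexity of \<open>exp (- X)\<close> along the martingale X: the
  sequence of \<open>j\<close> minus steps, of weight \<open>1 / 2 ^ j\<close>, raises X by at least
  \<open>\<eta> / 2\<close>, and this jump contributes to the drift.\<close>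

lemma avg_exp_cross_entropy_drift:
  assumes d: "0 < \<eta>" "\<eta> \<le> 1" and small: "c ^ (2 ^ j) \<le> \<eta> / 2 * ln 2" and c: "0 \<le> c"
  shows "exp (- 1) * (exp (- (\<eta> / 2)) - 1 + \<eta> / 2) / 2 ^ j * of_bool (cross_entropy \<mu> < 1 - \<eta> \<and> mean_tanh \<mu> < c)
    \<le> avg j (\<lambda>\<nu> _. exp (- cross_entropy \<nu>)) \<mu> k - exp (- cross_entropy \<mu>)"
proof -
  define x where "x = cross_entropy \<mu>"
  \<comment> \<open>The gap between \<open>exp (- y)\<close> and its tangent at \<open>x\<close>.
    The tangent averages to its value at \<open>x\<close> because the cross entropy is a
    martingale.\<close>
  define D where "D y = exp (- x) * (exp (- (y - x)) - 1 + (y - x))" for y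
  have D: "0 \<le> D y" for y
  proof -
    have "0 \<le> exp (- (y - x)) - 1 + (y - x)" using exp_ge_add_one_self[of "- (y - x)"] by linarith
    then show ?thesis unfolding D_def by simp
  qed
  have "D y = exp (- y) - exp (- x) * (1 + x) + exp (- x) * y" for y
    unfolding D_def by (simp add: algebra_simps exp_add[symmetric])
  then have "avg j (\<lambda>\<nu> _. D (cross_entropy \<nu>)) \<mu> k
      = avg j (\<lambda>\<nu> _. exp (- cross_entropy \<nu>)) \<mu> k - exp (- x) * (1 + x) + exp (- x) * x"
    by (simp add: avg_add avg_diff avg_cmult avg_cross_entropy x_def)
  then have eq: "avg j (\<lambda>\<nu> _. D (cross_entropy \<nu>)) \<mu> k
      = avg j (\<lambda>\<nu> _. exp (- cross_entropy \<nu>)) \<mu> k - exp (- x)"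
    by (simp add: algebra_simps)
  show ?thesis
  proof (cases "x < 1 - \<eta> \<and> mean_tanh \<mu> < c")
    case False
    have "0 \<le> avg j (\<lambda>\<nu> _. D (cross_entropy \<nu>)) \<mu> k" by (intro avg_nonneg D)
    then show ?thesis using False eq by (auto simp: x_def)
  next
    case True
    define y where "y = cross_entropy ((law_minus ^^ j) \<mu>)"
    have "1 - mean_tanh \<mu> / ln 2 < 1" using cross_entropy_ge_mean_tanh[of \<mu>] True d by (simp add: x_def)
    \<comment> \<open>A cross entropy below 1 makes the mean tanh positive, so that its powers are
      monotone in it.\<close>
    then have "0 < mean_tanh \<mu>" by (simp add: zero_less_divide_iff)
    then have "mean_tanh \<mu> ^ (2 ^ j) \<le> c ^ (2 ^ j)" using True by (intro power_mono) auto
    then have "mean_tanh ((law_minus ^^ j) \<mu>) \<le> \<eta> / 2 * ln 2"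
      using small by (simp add: mean_tanh_minus_power)
    then have "mean_tanh ((law_minus ^^ j) \<mu>) / ln 2 \<le> \<eta> / 2" by (simp add: field_simps)
    then have y: "\<eta> / 2 \<le> y - x"
      using cross_entropy_ge_mean_tanh[of "(law_minus ^^ j) \<mu>"] True unfolding y_def by linarith
    define h where "h = \<eta> / 2"
    define e where "e = y - x"
    \<comment> \<open>The gap is increasing in the jump \<open>e\<close> for
      \<open>e \<ge> h\<close>, so \<open>e\<close> may be replaced by its lower bound
      \<open>h\<close>.\<close>
    have "1 - (e - h) \<le> exp (- (e - h))" using exp_ge_add_one_self[of "- (e - h)"] by linarith
    then have "exp (- h) * (1 - (e - h)) \<le> exp (- h) * exp (- (e - h))"
      by (intro mult_left_mono) auto
    then have "exp (- h) - exp (- h) * (e - h) \<le> exp (- e)"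
      by (simp add: exp_add[symmetric] algebra_simps)
    moreover have "exp (- h) * (e - h) \<le> 1 * (e - h)"
      using y d by (intro mult_right_mono) (auto simp: h_def e_def)
    ultimately have "exp (- h) - 1 + h \<le> exp (- e) - 1 + e" by simp
    moreover have "exp (- 1) \<le> exp (- x)" using True d by simp
    moreover have "0 \<le> exp (- h) - 1 + h" using exp_ge_add_one_self[of "- h"] by simp
    ultimately have "exp (- 1) * (exp (- h) - 1 + h) \<le> D y"
      unfolding D_def e_def by (intro mult_mono) auto
    then have "exp (- 1) * (exp (- h) - 1 + h) / 2 ^ j \<le> D y / 2 ^ j" by (intro divide_right_mono) auto
    also have "\<dots> \<le> avg j (\<lambda>\<nu> _. D (cross_entropy \<nu>)) \<mu> k"
      unfolding y_def by (rule avg_ge_all_minus) (rule D)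
    finally show ?thesis using True eq by (simp add: x_def h_def)
  qed
qed

text \<open>While the unpolarized event has probability above \<delta>, the mean of
  \<open>exp (- X)\<close> gains at least \<open>\<kappa> * \<delta>\<close> every \<open>j\<close>
  steps. As this mean never exceeds 1, the event becomes rare at one of the first \<open>I\<close>
  multiples of \<open>j\<close>. The time may depend on the law, but its bound does not.\<close>

lemma early_polarization:
  assumes "0 < \<eta>" "\<eta> \<le> 1" "0 < \<eta>'" "\<eta>' < 1" "0 < \<delta>"
  shows "\<exists>m0. \<forall>\<mu>. \<exists>m\<le>m0.
    avg m (\<lambda>\<nu> _. of_bool (cross_entropy \<nu> < 1 - \<eta> \<and> mean_tanh \<nu> < 1 - \<eta>')) \<mu> 0 \<le> \<delta>"
proof -
  have "\<exists>j. (1 - \<eta>') ^ j < \<eta> / 2 * ln 2" using assms by (intro real_arch_pow_inv) auto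
  then obtain j where j: "(1 - \<eta>') ^ j < \<eta> / 2 * ln 2" by blast
  have "(1 - \<eta>') ^ (2 ^ j) \<le> (1 - \<eta>') ^ j" using assms by (intro power_decreasing) auto
  with j have j: "(1 - \<eta>') ^ (2 ^ j) \<le> \<eta> / 2 * ln 2" by simp
  define \<kappa> where "\<kappa> = exp (- 1) * (exp (- (\<eta> / 2)) - 1 + \<eta> / 2) / 2 ^ j"
  have "1 - \<eta> / 2 < exp (- (\<eta> / 2))" using exp_minus_greater[of "\<eta> / 2"] assms by simp
  then have \<kappa>: "0 < \<kappa>" unfolding \<kappa>_def by simp
  obtain I :: nat where I: "1 < real I * (\<kappa> * \<delta>)"
    using ex_less_of_nat_mult[of "\<kappa> * \<delta>" 1] \<kappa> assms by auto
  let ?P = "\<lambda>m \<mu>. avg m (\<lambda>\<nu> _. of_bool (cross_entropy \<nu> < 1 - \<eta> \<and> mean_tanh \<nu> < 1 - \<eta>')) \<mu> 0"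
  have "\<exists>i<I. ?P (i * j) \<mu> \<le> \<delta>" for \<mu>
  proof (rule ccontr)
    assume "\<not> (\<exists>i<I. ?P (i * j) \<mu> \<le> \<delta>)"
    then have large: "\<delta> \<le> ?P (i * j) \<mu>" if "i < I" for i using that by force
    let ?a = "\<lambda>n. avg n (\<lambda>\<nu> _. exp (- cross_entropy \<nu>)) \<mu> 0"
    have step: "?a (i * j) + \<kappa> * \<delta> \<le> ?a (Suc i * j)" if "i < I" for i
    proof -
      have "\<kappa> * \<delta> \<le> \<kappa> * ?P (i * j) \<mu>" using large[OF that] \<kappa> by simp
      also have "\<dots> \<le> avg (i * j) (\<lambda>\<nu> k. avg j (\<lambda>\<nu> _. exp (- cross_entropy \<nu>)) \<nu> k - exp (- cross_entropy \<nu>)) \<mu> 0"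
        unfolding avg_cmult[symmetric] \<kappa>_def
        using assms j by (intro avg_mono avg_exp_cross_entropy_drift) auto
      also have "\<dots> = ?a (i * j + j) - ?a (i * j)" by (simp add: avg_diff avg_append)
      finally show ?thesis by (simp add: add.commute)
    qed
    have "i \<le> I \<Longrightarrow> real i * (\<kappa> * \<delta>) \<le> ?a (i * j)" for i
    proof (induction i)
      case (Suc i)
      then show ?case using step[of i] by (simp add: distrib_right)
    qed simp
    then have "1 < ?a (I * j)" using I by fastforce
    moreover have "?a (I * j) \<le> 1" by (rule avg_le_const) (simp add: cross_entropy_nonneg)
    ultimately show False by simp
  qed
  then have "\<exists>m\<le>I * j. ?P m \<mu> \<le> \<delta>" for \<mu> by (meson less_imp_le mult_le_mono1)
  then show ?thesis by blast
qed

text \<open>Split at \<open>l = a powr z\<close>. Below it, \<open>l powr (1 / z) \<le> a\<close>;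
  above it, \<open>1 - (1 - l) / (1 + l) = 2 * l / (1 + l)\<close> is at least
  \<open>a powr z\<close>, which pays for the cap 2.\<close>

lemma capped_moment_le_mean_tanh:
  assumes "0 < z" "0 < a" "a \<le> 1"
  shows "capped_moment z \<mu> \<le> a + 2 / a powr z * (1 - mean_tanh \<mu>)"
proof -
  let ?b = "a powr z"
  have b: "0 < ?b" "?b \<le> 1" using assms by (simp_all add: powr_le1)
  have "min (l powr (1 / z)) 2 \<le> a + 2 / ?b * (1 - (1 - l) / (1 + l))" if "0 \<le> l" for l
  proof -
    have t: "1 - (1 - l) / (1 + l) = 2 * l / (1 + l)" using that by (simp add: field_simps)
    show ?thesis
    proof (cases "l \<le> ?b")
      case True
      have "l powr (1 / z) \<le> ?b powr (1 / z)" using True that assms by (intro powr_mono2) auto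
      also have "\<dots> = a" using assms by (simp add: powr_powr)
      finally have "min (l powr (1 / z)) 2 \<le> a" by simp
      moreover have "0 \<le> 2 / ?b * (2 * l / (1 + l))" using that b by simp
      ultimately show ?thesis unfolding t by linarith
    next
      case False
      have "?b * (1 + l) \<le> 2 * l" using False b mult_right_mono[of ?b 1 l] that by (simp add: distrib_left)
      then have "?b \<le> 2 * l / (1 + l)" using that by (simp add: field_simps)
      then have "2 / ?b * ?b \<le> 2 / ?b * (2 * l / (1 + l))" using b by (intro mult_left_mono) auto
      then have "2 \<le> 2 / ?b * (2 * l / (1 + l))" using b by simp
      moreover have "min (l powr (1 / z)) 2 \<le> 2" by simp
      ultimately show ?thesis using assms unfolding t by linarith
    qed
  qed
  then have "capped_moment z \<mu> \<le> mean \<mu> (\<lambda>l. a + 2 / ?b * (1 - (1 - l) / (1 + l)))"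
    unfolding capped_moment_def by (rule mean_mono)
  then show ?thesis by (simp only: mean_add mean_cmult mean_diff mean_const mean_tanh_def)
qed

lemma scale_potential_small:
  assumes "0 < s"
  shows "\<exists>z \<eta>'. 1 \<le> z \<and> 0 < \<eta>' \<and> \<eta>' < 1 \<and>
    (\<forall>\<mu>. cross_entropy \<mu> \<le> 1 \<longrightarrow> 1 - \<eta>' \<le> mean_tanh \<mu> \<longrightarrow> scale_potential z \<mu> \<le> s)"
proof -
  \<comment> \<open>First \<open>z\<close> makes the cross-entropy term at most
    \<open>s / 2\<close>; then \<open>a\<close> and \<eta>' make the capped moment at most
    \<open>2 * a \<le> (s / 2)\<^sup>2\<close>.\<close>
  define z where "z = max 1 ((32 / s)\<^sup>2)"
  define a where "a = min 1 ((s / 2)\<^sup>2 / 2)"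
  define \<eta>' where "\<eta>' = a * a powr z / 2"
  have z: "1 \<le> z" by (simp add: z_def)
  have a: "0 < a" "a \<le> 1" using assms by (simp_all add: a_def)
  have b: "0 < a powr z" "a powr z \<le> 1" using a z by (simp_all add: powr_le1)
  have "scale_potential z \<mu> \<le> s" if X: "cross_entropy \<mu> \<le> 1" and T: "1 - \<eta>' \<le> mean_tanh \<mu>" for \<mu>
  proof -
    have "capped_moment z \<mu> \<le> a + 2 / a powr z * (1 - mean_tanh \<mu>)"
      using a z by (intro capped_moment_le_mean_tanh) auto
    also have "\<dots> \<le> a + 2 / a powr z * \<eta>'"
      using T b by (intro add_left_mono mult_left_mono) auto
    also have "\<dots> = 2 * a" using b by (simp add: \<eta>'_def)
    also have "\<dots> \<le> (s / 2)\<^sup>2" by (simp add: a_def)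
    finally have 1: "sqrt (capped_moment z \<mu>) \<le> s / 2" using assms by (intro real_le_lsqrt) auto
    have "cross_entropy \<mu> / z \<le> 1 / z" using X z by (intro divide_right_mono) auto
    also have "\<dots> \<le> 1 / (32 / s)\<^sup>2" using assms by (intro divide_left_mono) (auto simp: z_def)
    also have "\<dots> = (s / 32)\<^sup>2" by (simp add: power_divide)
    finally have 2: "sqrt (cross_entropy \<mu> / z) \<le> s / 32" using assms by (intro real_le_lsqrt) auto
    show ?thesis unfolding scale_potential_def using 1 2 by simp
  qed
  moreover have "0 < \<eta>'" using a b by (simp add: \<eta>'_def)
  moreover have "\<eta>' < 1" using mult_mono[of a 1 "a powr z" 1] a b by (simp add: \<eta>'_def)
  ultimately show ?thesis using z by blast
qed

lemma avg_cross_entropy_large: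
  assumes "0 < c"
  shows "avg n (\<lambda>\<nu> _. of_bool (c \<le> cross_entropy \<nu>)) \<mu> k \<le> cross_entropy \<mu> / c"
proof -
  have "avg n (\<lambda>\<nu> _. of_bool (c \<le> cross_entropy \<nu>)) \<mu> k \<le> avg n (\<lambda>\<nu> _. 1 / c * cross_entropy \<nu>) \<mu> k"
    using assms cross_entropy_nonneg by (intro avg_mono) (auto simp: field_simps)
  then show ?thesis by (simp only: avg_cmult avg_cross_entropy) simp
qed

section \<open>Uniform polarization at the final threshold\<close>

text \<open>The correction \<open>n powr (3 / 4)\<close> dominates the fluctuations of order
  \<open>sqrt n\<close> of the number of plus steps and is of smaller order than \<open>n\<close>.
  Hence for N = 2^n the threshold is eventually below \<open>2 powr - (N powr \<beta>)\<close> for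
  each \<beta> < 1/2.\<close>

definition threshold :: "nat \<Rightarrow> real" where
  "threshold n = 2 powr - (2 powr (real n / 2 - real n powr (3 / 4)))"

text \<open>Failure means either a capped moment above \<zeta>, controlled by the potential, or a
  scale below \<open>B\<close>, controlled by Markov's inequality for the inverse scale.\<close>

lemma polarization_at_scale:
  assumes z: "1 \<le> z" and \<zeta>: "0 < \<zeta>" "\<zeta> \<le> 1 / 16" and \<delta>: "0 < \<delta>"
    and start: "scale_potential z \<mu> \<le> \<delta> * sqrt \<zeta>"
    and B: "B / z * (7 / 8) ^ n \<le> \<delta>" "0 < B"
  shows "avg n (\<lambda>\<nu> _. of_bool (\<not> (\<exists>j\<le>n. B \<le> z * (4 / 3) ^ j \<and> capped_moment (z * (4 / 3) ^ j) \<nu> \<le> \<zeta>))) \<mu> 0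
    \<le> 2 * \<delta>"
proof -
  have "of_bool (\<not> (\<exists>j\<le>n. B \<le> z * (4 / 3) ^ j \<and> capped_moment (z * (4 / 3) ^ j) \<nu> \<le> \<zeta>))
      \<le> of_bool (\<zeta> < capped_moment (z * (4 / 3) ^ j) \<nu>) + B / z * (3 / 4) ^ j" if "j \<le> n" for \<nu> j
  proof (cases "B \<le> z * (4 / 3) ^ j")
    case True
    have "0 \<le> B / z * (3 / 4) ^ j" using B z by simp
    moreover have "\<exists>j\<le>n. B \<le> z * (4 / 3) ^ j \<and> capped_moment (z * (4 / 3) ^ j) \<nu> \<le> \<zeta>"
      if "capped_moment (z * (4 / 3) ^ j) \<nu> \<le> \<zeta>" using True that \<open>j \<le> n\<close> by blast
    ultimately show ?thesis by (cases "capped_moment (z * (4 / 3) ^ j) \<nu> \<le> \<zeta>") auto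
  next
    case False
    have "1 = (4 / 3) ^ j * (3 / 4 :: real) ^ j" by (simp add: power_mult_distrib[symmetric])
    also have "\<dots> \<le> B / z * (3 / 4) ^ j" using False z by (intro mult_right_mono) (auto simp: field_simps)
    finally show ?thesis by (simp add: of_bool_def)
  qed
  then have "avg n (\<lambda>\<nu> _. of_bool (\<not> (\<exists>j\<le>n. B \<le> z * (4 / 3) ^ j \<and> capped_moment (z * (4 / 3) ^ j) \<nu> \<le> \<zeta>))) \<mu> 0
     \<le> avg n (\<lambda>\<nu> j. of_bool (\<zeta> < capped_moment (z * (4 / 3) ^ j) \<nu>) + B / z * (3 / 4) ^ j) \<mu> 0"
    by (intro avg_mono_count) simp
  also have "\<dots> = avg n (\<lambda>\<nu> j. of_bool (\<zeta> < capped_moment (z * (4 / 3) ^ j) \<nu>)) \<mu> 0 + B / z * (7 / 8) ^ n"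
    by (simp only: avg_add avg_cmult avg_inverse_scale) simp
  also have "avg n (\<lambda>\<nu> j. of_bool (\<zeta> < capped_moment (z * (4 / 3) ^ j) \<nu>)) \<mu> 0 \<le> \<delta>"
  proof -
    have "scale_potential z \<mu> / sqrt \<zeta> \<le> \<delta>" using start \<zeta> by (simp add: field_simps)
    then show ?thesis using avg_capped_moment_large[of z \<zeta> n \<mu> 0] z \<zeta> by simp
  qed
  finally show ?thesis using B by simp
qed

text \<open>At least \<open>n / 2 - t\<close> plus steps occur outside an event bounded by
  Chebyshev's inequality; outside another rare event the moment is at most
  \<open>2 powr - (2 ^ j)\<close> after \<open>j\<close> of them.\<close>

lemma fast_polarization:
  assumes "0 < \<theta>" "\<theta> \<le> 1" "0 < x" "moment \<theta> \<mu> \<le> 2 powr - (1 + x)" "0 < t"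
    and le: "2 powr - (2 powr (real n / 2 - t)) / (\<theta> * ln 2) \<le> \<epsilon>"
  shows "avg n (\<lambda>\<nu> _. of_bool (\<epsilon> < cross_entropy \<nu>)) \<mu> 0 \<le> 3 / x + real n / (4 * t\<^sup>2)"
proof -
  have "of_bool (\<epsilon> < cross_entropy \<nu>)
      \<le> of_bool (2 powr - (2 ^ j) < moment \<theta> \<nu>) + (of_bool (real j < real n / 2 - t) :: real)" for \<nu> j
  proof (cases "2 powr - (2 ^ j) < moment \<theta> \<nu> \<or> real j < real n / 2 - t")
    case False
    have "2 powr (real n / 2 - t) \<le> 2 powr real j" using False by (intro powr_mono) auto
    then have "2 powr (real n / 2 - t) \<le> 2 ^ j" by (simp add: powr_realpow)
    then have "2 powr - (2 ^ j) \<le> (2::real) powr - (2 powr (real n / 2 - t))" by (intro powr_mono) auto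
    then have "moment \<theta> \<nu> \<le> 2 powr - (2 powr (real n / 2 - t))" using False by linarith
    then have "moment \<theta> \<nu> / (\<theta> * ln 2) \<le> 2 powr - (2 powr (real n / 2 - t)) / (\<theta> * ln 2)"
      using assms by (intro divide_right_mono) auto
    then have "cross_entropy \<nu> \<le> \<epsilon>" using cross_entropy_le_moment[of \<theta> \<nu>] le assms by linarith
    then show ?thesis by simp
  qed (auto simp: of_bool_def)
  then have "avg n (\<lambda>\<nu> _. of_bool (\<epsilon> < cross_entropy \<nu>)) \<mu> 0
     \<le> avg n (\<lambda>\<nu> j. of_bool (2 powr - (2 ^ j) < moment \<theta> \<nu>) + of_bool (real j < real n / 2 - t)) \<mu> 0"
    by (intro avg_mono)
  also have "\<dots> \<le> 3 / x + real n / (4 * t\<^sup>2)"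
    unfolding avg_add using assms
    by (intro add_mono avg_moment_large avg_plus_count_small) auto
  finally show ?thesis .
qed

lemma eventually_threshold:
  assumes "0 < C"
  shows "\<forall>\<^sub>F n in sequentially. 2 powr - (2 powr (real n / 2 - real n powr (2 / 3))) * C \<le> threshold (n + T)"
proof -
  define c where "c = real T / 2 + 1"
  have 1: "\<forall>\<^sub>F n in sequentially. c + real n powr (2 / 3) \<le> real n powr (3 / 4)"
    by real_asymp
  have "filterlim (\<lambda>n. 2 powr (real n / 2 - real n powr (3 / 4))) at_top sequentially"
    by real_asymp
  then have "filterlim (\<lambda>n. 2 powr (real (n + T) / 2 - real (n + T) powr (3 / 4))) at_top sequentially"
    by (rule filterlim_compose[OF _ filterlim_add_const_nat_at_top])
  then have 2: "\<forall>\<^sub>F n in sequentially. log 2 C \<le> 2 powr (real (n + T) / 2 - real (n + T) powr (3 / 4))"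
    by (simp add: filterlim_at_top)
  from 1 2 show ?thesis
  proof eventually_elim
    case (elim n)
    define a where "a = real (n + T) / 2 - real (n + T) powr (3 / 4)"
    have "real n powr (3 / 4) \<le> real (n + T) powr (3 / 4)" by (intro powr_mono2) auto
    with elim have "a + 1 \<le> real n / 2 - real n powr (2 / 3)"
      unfolding a_def c_def by (simp add: add_divide_distrib)
    then have "2 powr (a + 1) \<le> 2 powr (real n / 2 - real n powr (2 / 3))" by (intro powr_mono) auto
    \<comment> \<open>The exponent has gained 1, so \<open>2 powr a\<close> appears twice; the
      second copy absorbs the constant \<open>log 2 C\<close>.\<close>
    then have "2 powr a + 2 powr a \<le> 2 powr (real n / 2 - real n powr (2 / 3))" by (simp add: powr_add)
    then have le: "- (2 powr (real n / 2 - real n powr (2 / 3))) \<le> - (2 powr a) - log 2 C"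
      using elim(2) unfolding a_def by linarith
    have "2 powr - (2 powr (real n / 2 - real n powr (2 / 3))) * C
        \<le> 2 powr (- (2 powr a) - log 2 C) * C"
      using assms le by (intro mult_right_mono powr_mono) auto
    also have "\<dots> = 2 powr - (2 powr a)" using assms by (simp add: powr_diff)
    finally show ?case by (simp add: threshold_def a_def)
  qed
qed

text \<open>The Markov property at time \<open>m\<close>: split according to whether the law reached
  then satisfies \<open>P\<close>.\<close>

lemma avg_of_bool_not_le:
  assumes "\<And>\<nu>. P \<nu> \<Longrightarrow> avg n f \<nu> 0 \<le> s" "\<And>\<nu> j. f \<nu> j \<le> 1" "0 \<le> s"
    "\<And>\<nu> j. f \<nu> j = f \<nu> 0"
  shows "avg (m + n) f \<mu> 0 \<le> avg m (\<lambda>\<nu> _. of_bool (\<not> P \<nu>)) \<mu> 0 + s"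
proof -
  have eq: "f = (\<lambda>\<nu> _. f \<nu> 0)" using assms(4) by (auto simp: fun_eq_iff)
  have "avg n f \<nu> k \<le> of_bool (\<not> P \<nu>) + s" for \<nu> k
  proof (cases "P \<nu>")
    case True
    have "avg n f \<nu> k = avg n f \<nu> 0" using avg_shift0[of n "\<lambda>\<nu>. f \<nu> 0" \<nu> k] eq by simp
    then show ?thesis using True assms(1) by simp
  next
    case False
    have "avg n f \<nu> k \<le> 1" by (rule avg_le_const) (rule assms(2))
    then show ?thesis using False assms(3) by simp
  qed
  then have "avg m (avg n f) \<mu> 0 \<le> avg m (\<lambda>\<nu> _. of_bool (\<not> P \<nu>) + s) \<mu> 0"
    by (intro avg_mono)
  then show ?thesis by (simp add: avg_append avg_add)
qed

text \<open>Three phases: at most \<open>m0\<close> steps of early polarization, growth of the scale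
  until time \<open>T\<close>, and doubly exponential decay afterwards. All constants depend on
  \<open>x\<close>, \<open>y\<close> and \<open>M\<close> only, which makes \<open>n0\<close>
  uniform in the law.\<close>

theorem uniform_polarization:
  assumes x: "0 \<le> x" "x < y" and M: "0 \<le> M"
  shows "\<exists>n0. \<forall>n\<ge>n0. \<forall>\<mu>. cross_entropy \<mu> \<le> x \<longrightarrow>
    (\<forall>\<rho>. 0 < \<rho> \<and> \<rho> \<le> 1 \<longrightarrow> excess_moment \<rho> \<mu> \<le> \<rho> * M) \<longrightarrow>
    avg n (\<lambda>\<nu> _. of_bool (threshold n < cross_entropy \<nu>)) \<mu> 0 \<le> y"
proof -
  define \<gamma> where "\<gamma> = y - x"
  \<comment> \<open>In all 6 \<delta> are spent: one on early polarization, two on the scale, one on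
    the excess moment and two on the last phase. This is less than
    \<open>\<gamma> / 2\<close>.\<close>
  define \<delta> where "\<delta> = min 1 (\<gamma> / 14)"
  \<comment> \<open>Chosen so that Markov's inequality for the event
    \<open>1 - \<eta> \<le> cross_entropy \<nu>\<close> loses at most
    \<open>\<gamma> / 2\<close>.\<close>
  define \<eta> where "\<eta> = \<gamma> / (2 * (x + \<gamma>))"
  \<comment> \<open>\<open>w\<close> is the slack for the last phase:
    \<open>3 / w = \<delta>\<close>, and \<open>2 * \<zeta> = 2 powr - (1 + w)\<close> is the moment
    at its start.\<close>
  define w where "w = 3 / \<delta>"
  define \<zeta> where "\<zeta> = (2::real) powr - (2 + w)"
  define A where "A = 1 + M * (2 / \<zeta> + 1) / \<delta>"
  have \<gamma>: "0 < \<gamma>" using x by (simp add: \<gamma>_def)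
  have \<delta>: "0 < \<delta>" "\<delta> \<le> 1" "14 * \<delta> \<le> \<gamma>" using \<gamma> by (auto simp: \<delta>_def)
  have \<eta>: "0 < \<eta>" "\<eta> < 1" using \<gamma> x by (simp_all add: \<eta>_def)
  have x\<eta>: "x / (1 - \<eta>) \<le> x + \<gamma> / 2"
  proof -
    have p: "0 < x + \<gamma>" "0 < 2 * x + \<gamma>" using x \<gamma> by auto
    have "x / (1 - \<eta>) = 2 * x * (x + \<gamma>) / (2 * x + \<gamma>)"
      using p by (simp add: \<eta>_def field_simps)
    also have "\<dots> \<le> x + \<gamma> / 2" using p x \<gamma> by (simp add: field_simps)
    finally show ?thesis .
  qed
  have w: "3 \<le> w" using \<delta> by (simp add: w_def field_simps)
  have \<zeta>: "0 < \<zeta>" "\<zeta> \<le> 1 / 16"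
  proof -
    have "\<zeta> \<le> 2 powr - 4" unfolding \<zeta>_def using w by (intro powr_mono) auto
    then show "\<zeta> \<le> 1 / 16" by (simp add: powr_minus)
  qed (simp add: \<zeta>_def)
  have A: "1 \<le> A" "M * (2 / \<zeta> + 1) / A \<le> \<delta>"
  proof -
    have nn: "0 \<le> M * (2 / \<zeta> + 1) / \<delta>" using M \<zeta> \<delta> by simp
    then show "1 \<le> A" by (simp add: A_def)
    have "M * (2 / \<zeta> + 1) / \<delta> \<le> A" by (simp add: A_def)
    then have "M * (2 / \<zeta> + 1) \<le> \<delta> * A" using \<delta> by (simp add: field_simps)
    then show "M * (2 / \<zeta> + 1) / A \<le> \<delta>" using \<open>1 \<le> A\<close> by (simp add: field_simps)
  qed
  obtain z \<eta>' where z: "1 \<le> z" and \<eta>': "0 < \<eta>'" "\<eta>' < 1" and start: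
    "\<And>\<mu>. cross_entropy \<mu> \<le> 1 \<Longrightarrow> 1 - \<eta>' \<le> mean_tanh \<mu> \<Longrightarrow> scale_potential z \<mu> \<le> \<delta> * sqrt \<zeta>"
    using scale_potential_small[of "\<delta> * sqrt \<zeta>"] \<delta> \<zeta> by (auto simp: zero_less_mult_iff)
  obtain m0 where m0: "\<And>\<mu>. \<exists>m\<le>m0.
      avg m (\<lambda>\<nu> _. of_bool (cross_entropy \<nu> < 1 - \<eta> \<and> mean_tanh \<nu> < 1 - \<eta>')) \<mu> 0 \<le> \<delta>"
    using early_polarization[of \<eta> \<eta>' \<delta>] \<eta> \<eta>' \<delta> by auto
  \<comment> \<open>A target scale linear in \<open>T\<close> is still reached with high
    probability, even if up to \<open>m0\<close> steps go to the first phase.\<close>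
  have "(\<lambda>T. A * real T * (7 / 8) ^ T) \<longlonglongrightarrow> 0"
  proof -
    have "(\<lambda>T. A * (real T * (7 / 8) ^ T)) \<longlonglongrightarrow> A * 0"
      by (intro tendsto_mult_left powser_times_n_limit_0) simp
    then show ?thesis by (simp add: mult.assoc)
  qed
  then have "\<forall>\<^sub>F T in sequentially. A * real T * (7 / 8) ^ T < \<delta> * (7 / 8) ^ m0"
    using \<delta> by (intro order_tendstoD) auto
  then have "\<forall>\<^sub>F T in sequentially. A * real T * (7 / 8) ^ T < \<delta> * (7 / 8) ^ m0 \<and> max 2 m0 \<le> T"
    by (intro eventually_conj eventually_ge_at_top)
  then obtain T where T: "A * real T * (7 / 8) ^ T < \<delta> * (7 / 8) ^ m0" "2 \<le> T" "m0 \<le> T"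
    unfolding eventually_sequentially by auto
  \<comment> \<open>With this target scale, \<open>\<rho> = 2 / B\<close> is of order
    \<open>1 / T\<close>, so the excess moment at \<rho> stays below \<zeta> over \<open>T\<close>
    steps with probability at least \<open>1 - \<delta>\<close>.\<close>
  define B where "B = A * real T"
  have B: "2 \<le> B" using A T mult_mono[of 1 A 2 "real T"] by (simp add: B_def)
  define \<rho> where "\<rho> = 2 / B"
  have \<rho>: "0 < \<rho>" "\<rho> \<le> 1" using B by (simp_all add: \<rho>_def)
  \<comment> \<open>The exponent may vary with the law, but the largest possible scale bounds it
    below uniformly.\<close>
  define good where "good \<nu> \<longleftrightarrow> (\<exists>\<theta>. 1 / (z * (4 / 3) ^ T) \<le> \<theta> \<and> \<theta> \<le> 1 \<and> moment \<theta> \<nu> \<le> 2 * \<zeta>)" for \<nu>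
  have z_pow: "1 \<le> z * (4 / 3) ^ j" for j
    using z mult_mono[of 1 z 1 "(4 / 3) ^ j"] by (simp add: one_le_power)
  have good: "avg T (\<lambda>\<nu> _. of_bool (\<not> good \<nu>)) \<mu> 0 \<le> x + \<gamma> / 2 + 4 * \<delta>"
    if X: "cross_entropy \<mu> \<le> x" and Mb: "excess_moment \<rho> \<mu> \<le> \<rho> * M" for \<mu>
  proof -
    obtain m where m: "m \<le> m0"
      "avg m (\<lambda>\<nu> _. of_bool (cross_entropy \<nu> < 1 - \<eta> \<and> mean_tanh \<nu> < 1 - \<eta>')) \<mu> 0 \<le> \<delta>"
      using m0 by blast
    define n where "n = T - m"
    have Tmn: "T = m + n" using m T by (simp add: n_def)
    let ?Q = "\<lambda>\<nu>. \<exists>j\<le>n. B \<le> z * (4 / 3) ^ j \<and> capped_moment (z * (4 / 3) ^ j) \<nu> \<le> \<zeta>"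
    let ?E = "\<lambda>\<nu>. \<not> (1 - \<eta> \<le> cross_entropy \<nu>) \<and> \<not> (cross_entropy \<nu> < 1 - \<eta> \<and> mean_tanh \<nu> < 1 - \<eta>')"
    have "of_bool (\<not> good \<nu>) \<le> of_bool (\<zeta> < excess_moment \<rho> \<nu>) + (of_bool (\<not> ?Q \<nu>) :: real)" for \<nu>
    proof (cases "\<zeta> < excess_moment \<rho> \<nu> \<or> \<not> ?Q \<nu>")
      case False
      then obtain j where j: "j \<le> n" "B \<le> z * (4 / 3) ^ j" "capped_moment (z * (4 / 3) ^ j) \<nu> \<le> \<zeta>"
        by blast
      have "moment (1 / (z * (4 / 3) ^ j)) \<nu> \<le> capped_moment (z * (4 / 3) ^ j) \<nu> + excess_moment \<rho> \<nu>"
        using j B z_pow by (intro moment_le_capped_moment) (auto simp: \<rho>_def intro!: divide_left_mono)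
      then have "moment (1 / (z * (4 / 3) ^ j)) \<nu> \<le> 2 * \<zeta>" using j False by simp
      moreover have "z * (4 / 3) ^ j \<le> z * (4 / 3) ^ T"
        using z j Tmn by (intro mult_left_mono power_increasing) auto
      then have "1 / (z * (4 / 3) ^ T) \<le> 1 / (z * (4 / 3) ^ j)"
        using z_pow[of j] by (intro divide_left_mono) (auto intro!: mult_pos_pos simp: z less_le_trans[OF zero_less_one])
      moreover have "1 / (z * (4 / 3) ^ j) \<le> 1" using z_pow[of j] by simp
      ultimately have "good \<nu>" unfolding good_def by blast
      then show ?thesis by simp
    qed (auto simp: of_bool_def)
    then have "avg T (\<lambda>\<nu> _. of_bool (\<not> good \<nu>)) \<mu> 0
       \<le> avg T (\<lambda>\<nu> _. of_bool (\<zeta> < excess_moment \<rho> \<nu>) + of_bool (\<not> ?Q \<nu>)) \<mu> 0"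
      by (intro avg_mono)
    also have "\<dots> = avg T (\<lambda>\<nu> _. of_bool (\<zeta> < excess_moment \<rho> \<nu>)) \<mu> 0 + avg T (\<lambda>\<nu> _. of_bool (\<not> ?Q \<nu>)) \<mu> 0"
      by (rule avg_add)
    also have "avg T (\<lambda>\<nu> _. of_bool (\<zeta> < excess_moment \<rho> \<nu>)) \<mu> 0 \<le> \<delta>"
    proof -
      have "avg T (\<lambda>\<nu> _. of_bool (\<zeta> < excess_moment \<rho> \<nu>)) \<mu> 0
          \<le> (1 / \<zeta> + real T / 2) * excess_moment \<rho> \<mu>"
        by (intro avg_excess_moment_large \<rho> \<zeta>)
      also have "\<dots> \<le> (1 / \<zeta> + real T / 2) * (\<rho> * M)" using Mb \<zeta> by (intro mult_left_mono) auto
      also have "\<dots> = M * (2 / \<zeta> / real T + 1) / A"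
        using A T by (simp add: \<rho>_def B_def field_simps)
      also have "\<dots> \<le> M * (2 / \<zeta> + 1) / A"
      proof -
        have "2 / \<zeta> / real T \<le> 2 / \<zeta> / 1" using \<zeta> T by (intro divide_left_mono) auto
        then show ?thesis using M A by (intro divide_right_mono mult_left_mono) auto
      qed
      finally show ?thesis using A by simp
    qed
    also have "avg T (\<lambda>\<nu> _. of_bool (\<not> ?Q \<nu>)) \<mu> 0 \<le> avg m (\<lambda>\<nu> _. of_bool (\<not> ?E \<nu>)) \<mu> 0 + 2 * \<delta>"
      unfolding Tmn
    proof (rule avg_of_bool_not_le)
      fix \<nu> assume "?E \<nu>"
      then have st: "scale_potential z \<nu> \<le> \<delta> * sqrt \<zeta>" using \<eta> by (intro start) auto
      have "(7 / 8 :: real) ^ m0 \<le> (7 / 8) ^ m" using m by (intro power_decreasing) auto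
      then have "\<delta> * (7 / 8) ^ m0 \<le> \<delta> * (7 / 8) ^ m" using \<delta> by (intro mult_left_mono) auto
      moreover have "B * (7 / 8) ^ T = B * (7 / 8) ^ n * (7 / 8) ^ m" by (simp add: Tmn power_add)
      ultimately have "B * (7 / 8) ^ n * (7 / 8) ^ m \<le> \<delta> * (7 / 8) ^ m"
        using T(1) unfolding B_def by linarith
      then have "B * (7 / 8) ^ n \<le> \<delta>" by simp
      moreover have "B / z \<le> B / 1" using z B by (intro divide_left_mono) auto
      then have "B / z * (7 / 8) ^ n \<le> B * (7 / 8) ^ n" by (intro mult_right_mono) auto
      ultimately show "avg n (\<lambda>\<nu> _. of_bool (\<not> ?Q \<nu>)) \<nu> 0 \<le> 2 * \<delta>"
        using B by (intro polarization_at_scale[OF z \<zeta> \<delta>(1) st]) auto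
    qed (use \<delta> in auto)
    also have "avg m (\<lambda>\<nu> _. of_bool (\<not> ?E \<nu>)) \<mu> 0
        \<le> avg m (\<lambda>\<nu> _. of_bool (1 - \<eta> \<le> cross_entropy \<nu>)
            + of_bool (cross_entropy \<nu> < 1 - \<eta> \<and> mean_tanh \<nu> < 1 - \<eta>')) \<mu> 0"
      by (intro avg_mono) auto
    also have "\<dots> \<le> cross_entropy \<mu> / (1 - \<eta>) + \<delta>"
      unfolding avg_add using \<eta> m by (intro add_mono avg_cross_entropy_large) auto
    also have "cross_entropy \<mu> / (1 - \<eta>) \<le> x / (1 - \<eta>)" using X \<eta> by (intro divide_right_mono) auto
    finally show ?thesis using x\<eta> by simp
  qed
  define \<theta>0 where "\<theta>0 = 1 / (z * (4 / 3) ^ T)"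
  have \<theta>0: "0 < \<theta>0" using z by (simp add: \<theta>0_def)
  \<comment> \<open>The deviation \<open>n powr (2 / 3)\<close> exceeds the order
    \<open>sqrt n\<close>, as Chebyshev's inequality requires, but stays below the
    \<open>n powr (3 / 4)\<close> of the threshold.\<close>
  have "(\<lambda>n. real n / (4 * (real n powr (2 / 3))\<^sup>2)) \<longlonglongrightarrow> 0" by real_asymp
  then have "\<forall>\<^sub>F n in sequentially. real n / (4 * (real n powr (2 / 3))\<^sup>2) < \<delta>"
    using \<delta> by (intro order_tendstoD) auto
  moreover have "\<forall>\<^sub>F n in sequentially.
      2 powr - (2 powr (real n / 2 - real n powr (2 / 3))) * (1 / (\<theta>0 * ln 2)) \<le> threshold (n + T)"
    using \<theta>0 by (intro eventually_threshold) auto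
  ultimately have "\<forall>\<^sub>F n in sequentially. real n / (4 * (real n powr (2 / 3))\<^sup>2) < \<delta> \<and>
      2 powr - (2 powr (real n / 2 - real n powr (2 / 3))) * (1 / (\<theta>0 * ln 2)) \<le> threshold (n + T) \<and> 1 \<le> n"
    by (intro eventually_conj eventually_ge_at_top)
  then obtain n1 where n1: "\<And>n. n1 \<le> n \<Longrightarrow> real n / (4 * (real n powr (2 / 3))\<^sup>2) < \<delta> \<and>
      2 powr - (2 powr (real n / 2 - real n powr (2 / 3))) * (1 / (\<theta>0 * ln 2)) \<le> threshold (n + T) \<and> 1 \<le> n"
    unfolding eventually_sequentially by blast
  have "avg n (\<lambda>\<nu> _. of_bool (threshold n < cross_entropy \<nu>)) \<mu> 0 \<le> y"
    if n: "n1 + T \<le> n" and X: "cross_entropy \<mu> \<le> x"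
      and Mb: "\<forall>\<rho>. 0 < \<rho> \<and> \<rho> \<le> 1 \<longrightarrow> excess_moment \<rho> \<mu> \<le> \<rho> * M" for n \<mu>
  proof -
    define k where "k = n - T"
    have nk: "n = T + k" "n1 \<le> k" using n by (auto simp: k_def)
    have "avg n (\<lambda>\<nu> _. of_bool (threshold n < cross_entropy \<nu>)) \<mu> 0
        \<le> avg T (\<lambda>\<nu> _. of_bool (\<not> good \<nu>)) \<mu> 0 + 2 * \<delta>"
      unfolding nk(1)
    proof (rule avg_of_bool_not_le)
      fix \<nu> assume "good \<nu>"
      then obtain \<theta> where \<theta>: "\<theta>0 \<le> \<theta>" "\<theta> \<le> 1" "moment \<theta> \<nu> \<le> 2 * \<zeta>"
        unfolding good_def \<theta>0_def by blast
      have "2 * \<zeta> = 2 powr - (1 + w)" using powr_add[of "2::real" 1 "- (2 + w)"] by (simp add: \<zeta>_def)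
      have "2 powr - (2 powr (real k / 2 - real k powr (2 / 3))) / (\<theta> * ln 2)
          \<le> 2 powr - (2 powr (real k / 2 - real k powr (2 / 3))) / (\<theta>0 * ln 2)"
        using \<theta> \<theta>0 by (intro divide_left_mono mult_right_mono mult_pos_pos) auto
      also have "\<dots> \<le> threshold (T + k)" using n1[OF nk(2)] by (simp add: add.commute)
      finally have "avg k (\<lambda>\<nu> _. of_bool (threshold (T + k) < cross_entropy \<nu>)) \<nu> 0
          \<le> 3 / w + real k / (4 * (real k powr (2 / 3))\<^sup>2)"
        using \<theta> \<theta>0 w n1[OF nk(2)] \<open>2 * \<zeta> = 2 powr - (1 + w)\<close> by (intro fast_polarization) auto
      also have "3 / w = \<delta>" using \<delta> by (simp add: w_def)
      finally show "avg k (\<lambda>\<nu> _. of_bool (threshold (T + k) < cross_entropy \<nu>)) \<nu> 0 \<le> 2 * \<delta>"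
        using n1[OF nk(2)] by simp
    qed (use \<delta> in auto)
    also have "avg T (\<lambda>\<nu> _. of_bool (\<not> good \<nu>)) \<mu> 0 \<le> x + \<gamma> / 2 + 4 * \<delta>"
      using X Mb \<rho> by (intro good) auto
    also have "x + \<gamma> / 2 + 4 * \<delta> + 2 * \<delta> \<le> y" using \<delta>(1,3) \<gamma>_def by linarith
    finally show ?thesis by simp
  qed
  then show ?thesis by blast
qed

section \<open>Recursion for the synthetic channels\<close>

lemma UNIV_bit: "(UNIV :: bit set) = {0, 1}"
  by (auto intro: bit.exhaust)

lemma bit_add_self [simp]: "a + (a + b) = b" "a + b + b = a" "a + a = 0" for a b :: bit
  by (cases a; cases b; simp)+

lemma sum_bit: "(\<Sum>x\<in>{0, 1 :: bit}. f x) = f 0 + f 1"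
  by simp

lemma finite_bit_lists: "finite {us :: bit list. length us = k}"
proof -
  have "finite (UNIV :: bit set)" by (simp add: UNIV_bit)
  then show ?thesis using finite_lists_length_eq[of "UNIV :: bit set" k] by simp
qed

lemma finite_lists: "finite {ys :: 'y::finite list. length ys = k}"
  using finite_lists_length_eq[of "UNIV :: 'y set" k] by simp

lemma finite_synthetic_outputs: "finite (synthetic_outputs n i :: ('y::finite list \<times> bit list) set)"
proof -
  have "synthetic_outputs n i = {ys :: 'y list. length ys = 2 ^ n} \<times> {us. length us = i}"
    by (auto simp: synthetic_outputs_def)
  then show ?thesis by (simp add: finite_lists finite_bit_lists)
qed

lemma sum_list_Suc:
  fixes F :: "bit list \<Rightarrow> real"
  shows "(\<Sum>vs | length vs = Suc k. F vs) = (\<Sum>v\<in>{0, 1}. \<Sum>vs | length vs = k. F (v # vs))"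
proof -
  have "(\<Sum>v\<in>{0, 1}. \<Sum>vs | length vs = k. F (v # vs)) = (\<Sum>(v, vs)\<in>{0, 1} \<times> {vs. length vs = k}. F (v # vs))"
    by (rule sum.cartesian_product)
  also have "\<dots> = (\<Sum>vs | length vs = Suc k. F vs)"
    by (rule sum.reindex_bij_witness[of _ "\<lambda>vs. (hd vs, tl vs)" "\<lambda>(v, vs). v # vs"])
      (auto simp: length_Suc_conv UNIV_bit[symmetric])
  finally show ?thesis by simp
qed

lemma sum_list_append:
  fixes F :: "bit list \<Rightarrow> real"
  shows "(\<Sum>us | length us = m + k. F us) = (\<Sum>us | length us = m. \<Sum>vs | length vs = k. F (us @ vs))"
proof -
  have "(\<Sum>us | length us = m. \<Sum>vs | length vs = k. F (us @ vs))
      = (\<Sum>(us, vs)\<in>{us. length us = m} \<times> {vs. length vs = k}. F (us @ vs))"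
    by (rule sum.cartesian_product)
  also have "\<dots> = (\<Sum>us | length us = m + k. F us)"
    by (rule sum.reindex_bij_witness[of _ "\<lambda>us. (take m us, drop m us)" "\<lambda>(us, vs). us @ vs"]) auto
  finally show ?thesis by simp
qed

text \<open>
  With the bit-reversed generator, the encoding of \<open>us\<close> is the encoding of the sums of consecutive pairs
  followed by the encoding of their second entries.
\<close>

fun pair_sums :: "bit list \<Rightarrow> bit list" where
  "pair_sums (a # b # us) = (a + b) # pair_sums us"
| "pair_sums us = []"

fun pair_seconds :: "bit list \<Rightarrow> bit list" where
  "pair_seconds (a # b # us) = b # pair_seconds us"
| "pair_seconds us = []"

fun interleave :: "bit list \<Rightarrow> bit list \<Rightarrow> bit list" where
  "interleave (a # as) (b # bs) = (a + b) # b # interleave as bs"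
| "interleave as bs = []"

lemma length_pairs [simp]:
  "length (pair_sums us) = length us div 2" "length (pair_seconds us) = length us div 2"
  by (induction us rule: pair_sums.induct) simp_all

lemma pairs_append:
  assumes "even (length us)"
  shows "pair_sums (us @ vs) = pair_sums us @ pair_sums vs"
    "pair_seconds (us @ vs) = pair_seconds us @ pair_seconds vs"
  using assms by (induction us rule: pair_sums.induct) simp_all

lemma pairs_nth:
  assumes "i < length us div 2"
  shows "pair_sums us ! i = us ! (2 * i) + us ! (2 * i + 1)" "pair_seconds us ! i = us ! (2 * i + 1)"
  using assms
proof (induction us arbitrary: i rule: pair_sums.induct)
  case (1 a b us)
  {
    case 1
    then show ?case using "1.IH"(1)[of "i - 1"] by (cases i) simp_all
  next
    case 2
    then show ?case using "1.IH"(2)[of "i - 1"] by (cases i) simp_all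
  }
qed simp_all

lemma interleave_pairs:
  "even (length us) \<Longrightarrow> interleave (pair_sums us) (pair_seconds us) = us"
  by (induction us rule: pair_sums.induct) (simp_all del: add_bit_eq_xor)

lemma pairs_interleave:
  assumes "length as = length bs"
  shows "pair_sums (interleave as bs) = as" "pair_seconds (interleave as bs) = bs"
    "length (interleave as bs) = 2 * length as"
  using assms by (induction as bs rule: list_induct2) (simp_all del: add_bit_eq_xor)

lemma sum_pairs:
  fixes F :: "bit list \<Rightarrow> bit list \<Rightarrow> real"
  shows "(\<Sum>us | length us = 2 * k. F (pair_sums us) (pair_seconds us))
    = (\<Sum>as | length as = k. \<Sum>bs | length bs = k. F as bs)"
proof -
  have "(\<Sum>as | length as = k. \<Sum>bs | length bs = k. F as bs)
      = (\<Sum>(as, bs)\<in>{as. length as = k} \<times> {bs. length bs = k}. F as bs)"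
    by (rule sum.cartesian_product)
  also have "\<dots> = (\<Sum>us | length us = 2 * k. F (pair_sums us) (pair_seconds us))"
    by (rule sum.reindex_bij_witness[of _ "\<lambda>us. (pair_sums us, pair_seconds us)" "\<lambda>(as, bs). interleave as bs"])
      (auto simp: interleave_pairs pairs_interleave)
  finally show ?thesis by simp
qed

lemma sum_even_odd: "(\<Sum>i<2 * m. f i) = (\<Sum>i<m. f (2 * i) + f (2 * i + 1))"
  for f :: "nat \<Rightarrow> 'a::comm_monoid_add"
  by (induction m) (simp_all add: add.assoc)

lemma prod_lessThan_add: "(\<Prod>j<m + k. f j) = (\<Prod>j<m. f j) * (\<Prod>j<k. f (m + j))"
  for f :: "nat \<Rightarrow> 'a::comm_monoid_mult"
  by (induction k) (simp_all add: mult.assoc)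

lemma bit_reversal_less: "bit_reversal n i < 2 ^ n"
proof (induction n arbitrary: i)
  case (Suc n)
  have "(i mod 2) * 2 ^ n \<le> 1 * 2 ^ n" by (intro mult_right_mono) auto
  then show ?case using Suc[of "i div 2"] unfolding bit_reversal.simps power_Suc by linarith
qed simp

text \<open>Bit reversal moves the lowest digit of the row index to the top, where it selects the
  row of the outermost kernel factor. Thus inputs are paired with their neighbours while outputs
  split into two halves.\<close>

lemma polar_generator_Suc:
  "polar_generator (Suc n) i j = kernel (i mod 2) (j div 2 ^ n) * polar_generator n (i div 2) (j mod 2 ^ n)"
  using bit_reversal_less[of n "i div 2"] by (simp add: polar_generator_def)

lemma length_polar_encode [simp]: "length (polar_encode n us) = 2 ^ n"
  by (simp add: polar_encode_def)

lemma polar_encode_Suc: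
  assumes "length us = 2 ^ Suc n" "j < 2 ^ n"
  shows "polar_encode (Suc n) us ! j = polar_encode n (pair_sums us) ! j"
    and "polar_encode (Suc n) us ! (2 ^ n + j) = polar_encode n (pair_seconds us) ! j"
proof -
  have len: "length us div 2 = 2 ^ n" using assms by simp
  have s: "(\<Sum>i<2 ^ Suc n. f i) = (\<Sum>i<2 ^ n. f (2 * i) + f (2 * i + 1))" for f :: "nat \<Rightarrow> bit"
    using sum_even_odd[of f "2 ^ n"] by simp
  show "polar_encode (Suc n) us ! j = polar_encode n (pair_sums us) ! j"
    unfolding polar_encode_def s
    using assms len pairs_nth(1)[of _ us]
    by (simp add: polar_generator_Suc kernel_def distrib_right del: add_bit_eq_xor mult_bit_eq_and)
  show "polar_encode (Suc n) us ! (2 ^ n + j) = polar_encode n (pair_seconds us) ! j"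
    unfolding polar_encode_def s
    using assms len pairs_nth(2)[of _ us]
    by (simp add: polar_generator_Suc kernel_def del: add_bit_eq_xor mult_bit_eq_and)
qed

section \<open>One-step recursion for the synthetic channels\<close>

definition likelihood :: "nat \<Rightarrow> 'y channel \<Rightarrow> bit list \<Rightarrow> 'y list \<Rightarrow> real" where
  "likelihood n W us ys = (\<Prod>j<2 ^ n. W (polar_encode n us ! j) (ys ! j))"

lemma likelihood_Suc:
  assumes "length us = 2 ^ Suc n" "length ys = 2 ^ Suc n"
  shows "likelihood (Suc n) W us ys
    = likelihood n W (pair_sums us) (take (2 ^ n) ys) * likelihood n W (pair_seconds us) (drop (2 ^ n) ys)"
proof -
  have "(2::nat) ^ Suc n = 2 ^ n + 2 ^ n" by simp
  then show ?thesis
    unfolding likelihood_def using assms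
    by (simp only: prod_lessThan_add) (simp add: polar_encode_Suc)
qed

lemma synthetic_channel_eq:
  "synthetic_channel n i W u (ys, us)
    = 1 / 2 ^ (2 ^ n - 1) * (\<Sum>vs | length vs = 2 ^ n - 1 - i. likelihood n W (us @ u # vs) ys)"
  by (simp add: synthetic_channel_def likelihood_def sum_distrib_left)

lemma scale_Suc: "1 / 2 ^ (2 ^ Suc n - 1) = 1 / 2 * (1 / 2 ^ (2 ^ n - 1)) * (1 / 2 ^ (2 ^ n - 1) :: real)"
proof -
  have "(2::nat) ^ Suc n - 1 = Suc ((2 ^ n - 1) + (2 ^ n - 1))"
    using one_le_power[of "2::nat" n] unfolding power_Suc by arith
  then show ?thesis by (simp only: power_Suc power_add) simp
qed

text \<open>The past has even length \<open>2 * i\<close>, so \<open>a\<close> and \<open>u\<close>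
  form a pair and the future splits into pairs. Sums and seconds of the future pairs range
  independently over all lists, so the sum factors.\<close>

lemma sum_likelihood_Suc:
  assumes i: "i < 2 ^ n" and len: "length us = 2 * i" "length ys = 2 ^ Suc n"
  shows "(\<Sum>ws | length ws = 2 * (2 ^ n - 1 - i). likelihood (Suc n) W (us @ a # u # ws) ys)
    = (\<Sum>vs | length vs = 2 ^ n - 1 - i. likelihood n W (pair_sums us @ (a + u) # vs) (take (2 ^ n) ys))
      * (\<Sum>vs | length vs = 2 ^ n - 1 - i. likelihood n W (pair_seconds us @ u # vs) (drop (2 ^ n) ys))"
proof -
  let ?k = "2 ^ n - 1 - i"
  have "likelihood (Suc n) W (us @ a # u # ws) ys
      = likelihood n W (pair_sums us @ (a + u) # pair_sums ws) (take (2 ^ n) ys)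
        * likelihood n W (pair_seconds us @ u # pair_seconds ws) (drop (2 ^ n) ys)"
    if "length ws = 2 * ?k" for ws
    using that i len by (subst likelihood_Suc) (simp_all add: pairs_append del: add_bit_eq_xor)
  then have "(\<Sum>ws | length ws = 2 * ?k. likelihood (Suc n) W (us @ a # u # ws) ys)
      = (\<Sum>ws | length ws = 2 * ?k. likelihood n W (pair_sums us @ (a + u) # pair_sums ws) (take (2 ^ n) ys)
        * likelihood n W (pair_seconds us @ u # pair_seconds ws) (drop (2 ^ n) ys))"
    by (intro sum.cong) auto
  also have "\<dots> = (\<Sum>as | length as = ?k. \<Sum>bs | length bs = ?k.
        likelihood n W (pair_sums us @ (a + u) # as) (take (2 ^ n) ys)
        * likelihood n W (pair_seconds us @ u # bs) (drop (2 ^ n) ys))"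
    by (rule sum_pairs)
  finally show ?thesis by (simp only: sum_product)
qed

lemma synthetic_channel_plus:
  assumes i: "i < 2 ^ n" and len: "length us = 2 * i" "length ys = 2 ^ Suc n"
  shows "synthetic_channel (Suc n) (2 * i + 1) W u (ys, us @ [a])
    = 1 / 2 * synthetic_channel n i W (a + u) (take (2 ^ n) ys, pair_sums us)
      * synthetic_channel n i W u (drop (2 ^ n) ys, pair_seconds us)"
proof -
  have k: "2 ^ Suc n - 1 - (2 * i + 1) = 2 * (2 ^ n - 1 - i)" by simp
  show ?thesis
    unfolding synthetic_channel_eq scale_Suc k
    using sum_likelihood_Suc[OF assms, of W a u] by (simp del: add_bit_eq_xor)
qed

text \<open>At the first bit of a pair the second bit \<open>v\<close> still belongs to the future
  and is summed out. With positions counted from 0, even positions carry the minus step and odd ones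
  the plus step.\<close>

lemma synthetic_channel_minus:
  assumes i: "i < 2 ^ n" and len: "length us = 2 * i" "length ys = 2 ^ Suc n"
  shows "synthetic_channel (Suc n) (2 * i) W u (ys, us)
    = 1 / 2 * (\<Sum>v\<in>{0, 1}. synthetic_channel n i W (u + v) (take (2 ^ n) ys, pair_sums us)
      * synthetic_channel n i W v (drop (2 ^ n) ys, pair_seconds us))"
proof -
  have k: "2 ^ Suc n - 1 - 2 * i = Suc (2 * (2 ^ n - 1 - i))" using i by simp
  show ?thesis
    unfolding synthetic_channel_eq scale_Suc k sum_list_Suc
    by (simp only: sum_likelihood_Suc[OF assms] sum_bit) (simp add: algebra_simps del: add_bit_eq_xor)
qed

section \<open>Likelihood ratios of synthetic channels\<close>

text \<open>Absolute continuity of \<open>W\<close> with respect to \<open>V\<close>, which excludes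
  the summands \<open>- \<infinity>\<close> in the mismatched information.\<close>

definition dominated :: "'o channel \<Rightarrow> 'o channel \<Rightarrow> bool" where
  "dominated W V \<longleftrightarrow> (\<forall>x y. 0 \<le> W x y \<and> 0 \<le> V x y \<and> (W x y \<noteq> 0 \<longrightarrow> V x y \<noteq> 0))"

lemma synthetic_channel_nonneg:
  assumes "\<And>x y. 0 \<le> W x y" shows "0 \<le> synthetic_channel n i W u o'"
  using assms by (cases o') (auto simp: synthetic_channel_def intro!: sum_nonneg divide_nonneg_nonneg prod_nonneg)

text \<open>A nonzero summand for \<open>W\<close> is nonzero for \<open>V\<close>, and the
  nonnegative summands for \<open>V\<close> cannot cancel.\<close>

lemma dominated_synthetic_channel:
  assumes "dominated W V" shows "dominated (synthetic_channel n i W) (synthetic_channel n i V)"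
proof -
  have nn: "\<And>x y. 0 \<le> W x y" "\<And>x y. 0 \<le> V x y" and WV: "\<And>x y. W x y \<noteq> 0 \<Longrightarrow> V x y \<noteq> 0"
    using assms by (auto simp: dominated_def)
  have "synthetic_channel n i V u (ys, us) \<noteq> 0" if "synthetic_channel n i W u (ys, us) \<noteq> 0" for u ys us
  proof -
    let ?S = "{vs :: bit list. length vs = 2 ^ n - 1 - i}"
    from that have "\<exists>vs\<in>?S. likelihood n W (us @ u # vs) ys \<noteq> 0"
      unfolding synthetic_channel_eq by (metis (mono_tags, lifting) mult_zero_right sum.neutral)
    then obtain vs where vs: "vs \<in> ?S" "likelihood n W (us @ u # vs) ys \<noteq> 0" by blast
    then have "likelihood n V (us @ u # vs) ys \<noteq> 0"
      using WV by (simp add: likelihood_def)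
    moreover have "0 \<le> likelihood n V vs ys" for vs
      unfolding likelihood_def by (intro prod_nonneg ballI nn)
    ultimately have "0 < (\<Sum>vs\<in>?S. likelihood n V (us @ u # vs) ys)"
      using vs(1) by (intro sum_pos2[OF finite_bit_lists vs(1)]) (auto simp: less_le)
    then show ?thesis unfolding synthetic_channel_eq by simp
  qed
  then show ?thesis
    unfolding dominated_def using nn by (auto intro: synthetic_channel_nonneg)
qed

text \<open>\<open>x + 1\<close> is the flipped bit. Where \<open>V x y = 0\<close> the ratio takes
  the default value 0; under domination such points carry no weight.\<close>

definition likelihood_ratio :: "'o channel \<Rightarrow> bit \<Rightarrow> 'o \<Rightarrow> real" where
  "likelihood_ratio V x y = V (x + 1) y / V x y"

definition ratio_mean :: "'o set \<Rightarrow> 'o channel \<Rightarrow> 'o channel \<Rightarrow> (real \<Rightarrow> real) \<Rightarrow> real" where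
  "ratio_mean Y W V f = (\<Sum>y\<in>Y. \<Sum>x\<in>{0, 1}. 1 / 2 * W x y * f (likelihood_ratio V x y))"

lemma sum_minus_ratio:
  assumes A: "dominated A a"
  shows "(\<Sum>u\<in>{0, 1}. 1 / 2 * (1 / 2 * (\<Sum>v\<in>{0, 1}. A (u + v) y * A v z)) *
      f ((1 / 2 * (\<Sum>v\<in>{0, 1}. a (u + 1 + v) y * a v z)) / (1 / 2 * (\<Sum>v\<in>{0, 1}. a (u + v) y * a v z))))
    = (\<Sum>u\<in>{0, 1}. \<Sum>v\<in>{0, 1}. 1 / 2 * A u y * (1 / 2 * A v z *
      f ((likelihood_ratio a u y + likelihood_ratio a v z) / (1 + likelihood_ratio a u y * likelihood_ratio a v z))))"
proof -
  let ?r = "\<lambda>u. (1 / 2 * (\<Sum>v\<in>{0, 1}. a (u + 1 + v) y * a v z)) / (1 / 2 * (\<Sum>v\<in>{0, 1}. a (u + v) y * a v z))"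
  let ?h = "\<lambda>u v. (likelihood_ratio a u y + likelihood_ratio a v z) / (1 + likelihood_ratio a u y * likelihood_ratio a v z)"
  have half: "(1 / 2 * p) / (1 / 2 * q) = p / q" for p q :: real by simp
  \<comment> \<open>The substitution of \<open>u + v\<close> for \<open>u\<close> makes
    \<open>u\<close> and \<open>v\<close> the two channel inputs. The ratio identity is used only
    where the weights are nonzero, which makes the denominators positive.\<close>
  have key: "A u y * A v z * f (?r (u + v)) = A u y * A v z * f (?h u v)" for u v
  proof (cases "A u y = 0 \<or> A v z = 0")
    case False
    then have p: "0 < a u y" "0 < a v z" "0 \<le> a (u + 1) y" "0 \<le> a (v + 1) z"
      using A by (auto simp: dominated_def less_le)
    have "?r (u + v) = (a (u + 1) y * a v z + a u y * a (v + 1) z) / (a u y * a v z + a (u + 1) y * a (v + 1) z)"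
      unfolding half sum_bit by (cases u; cases v; simp add: add.commute)
    also have "\<dots> = ?h u v"
    proof -
      have "0 < a u y * a v z + a (u + 1) y * a (v + 1) z" using p by (simp add: add_pos_nonneg)
      moreover have "1 + likelihood_ratio a u y * likelihood_ratio a v z
          = (a u y * a v z + a (u + 1) y * a (v + 1) z) / (a u y * a v z)"
        "likelihood_ratio a u y + likelihood_ratio a v z
          = (a (u + 1) y * a v z + a u y * a (v + 1) z) / (a u y * a v z)"
        unfolding likelihood_ratio_def using p by (simp_all add: field_simps del: add_bit_eq_xor)
      ultimately show ?thesis using p by simp
    qed
    finally show ?thesis by simp
  qed auto
  have "(\<Sum>u\<in>{0, 1}. 1 / 2 * (1 / 2 * (\<Sum>v\<in>{0, 1}. A (u + v) y * A v z)) * f (?r u))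
      = 1 / 4 * (\<Sum>u\<in>{0, 1}. \<Sum>v\<in>{0, 1}. A u y * A v z * f (?r (u + v)))"
    unfolding sum_bit by (simp add: algebra_simps)
  also have "\<dots> = 1 / 4 * (\<Sum>u\<in>{0, 1}. \<Sum>v\<in>{0, 1}. A u y * A v z * f (?h u v))"
    by (simp only: key)
  also have "\<dots> = (\<Sum>u\<in>{0, 1}. \<Sum>v\<in>{0, 1}. 1 / 2 * A u y * (1 / 2 * A v z * f (?h u v)))"
    unfolding sum_bit by (simp add: algebra_simps)
  finally show ?thesis .
qed

text \<open>Reindexing by the first channel input \<open>s + u\<close>. The ratio factors even where
  a denominator is 0, as both sides then have the value 0 of a division by zero.\<close>

lemma sum_plus_ratio:
  fixes A :: "'o channel" and f :: "real \<Rightarrow> real"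
  shows "(\<Sum>s\<in>{0, 1}. \<Sum>u\<in>{0, 1}. 1 / 2 * (1 / 2 * A (s + u) y * A u z) *
      f ((1 / 2 * a (s + (u + 1)) y * a (u + 1) z) / (1 / 2 * a (s + u) y * a u z)))
    = (\<Sum>u\<in>{0, 1}. \<Sum>v\<in>{0, 1}. 1 / 2 * A u y * (1 / 2 * A v z *
      f (likelihood_ratio a u y * likelihood_ratio a v z)))"
  by (simp add: likelihood_ratio_def algebra_simps)

lemma sum_synthetic_outputs_minus:
  fixes G :: "'y list \<times> bit list \<Rightarrow> 'y list \<times> bit list \<Rightarrow> real"
  shows "(\<Sum>(ys, us)\<in>synthetic_outputs (Suc n) (2 * i).
      G (take (2 ^ n) ys, pair_sums us) (drop (2 ^ n) ys, pair_seconds us))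
    = (\<Sum>y\<in>synthetic_outputs n i. \<Sum>z\<in>synthetic_outputs n i. G y z)"
proof -
  have "(\<Sum>y\<in>synthetic_outputs n i. \<Sum>z\<in>synthetic_outputs n i. G y z)
      = (\<Sum>(y, z)\<in>synthetic_outputs n i \<times> synthetic_outputs n i. G y z)"
    by (rule sum.cartesian_product)
  also have "\<dots> = (\<Sum>(ys, us)\<in>synthetic_outputs (Suc n) (2 * i).
      G (take (2 ^ n) ys, pair_sums us) (drop (2 ^ n) ys, pair_seconds us))"
    by (rule sum.reindex_bij_witness[of _
      "\<lambda>(ys, us). ((take (2 ^ n) ys, pair_sums us), (drop (2 ^ n) ys, pair_seconds us))"
      "\<lambda>((ys, as), (zs, bs)). (ys @ zs, interleave as bs)"])
      (auto simp: synthetic_outputs_def interleave_pairs pairs_interleave)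
  finally show ?thesis by simp
qed

lemma sum_synthetic_outputs_plus:
  fixes G :: "bit \<Rightarrow> 'y list \<times> bit list \<Rightarrow> 'y list \<times> bit list \<Rightarrow> real"
  shows "(\<Sum>(ys, us)\<in>synthetic_outputs (Suc n) (2 * i + 1).
      G (last us) (take (2 ^ n) ys, pair_sums (butlast us)) (drop (2 ^ n) ys, pair_seconds (butlast us)))
    = (\<Sum>y\<in>synthetic_outputs n i. \<Sum>z\<in>synthetic_outputs n i. \<Sum>s\<in>{0, 1}. G s y z)"
proof -
  have "(\<Sum>y\<in>synthetic_outputs n i. \<Sum>z\<in>synthetic_outputs n i. \<Sum>s\<in>{0, 1}. G s y z)
      = (\<Sum>(y, z, s)\<in>synthetic_outputs n i \<times> synthetic_outputs n i \<times> {0, 1}. G s y z)"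
    by (simp only: sum.cartesian_product split_def fst_conv snd_conv)
  also have "\<dots> = (\<Sum>(ys, us)\<in>synthetic_outputs (Suc n) (2 * i + 1).
      G (last us) (take (2 ^ n) ys, pair_sums (butlast us)) (drop (2 ^ n) ys, pair_seconds (butlast us)))"
  proof (rule sum.reindex_bij_witness[of _
      "\<lambda>(ys, us). ((take (2 ^ n) ys, pair_sums (butlast us)), (drop (2 ^ n) ys, pair_seconds (butlast us)), last us)"
      "\<lambda>((ys, as), (zs, bs), s). (ys @ zs, interleave as bs @ [s])"], goal_cases)
    case (3 b)
    obtain ys us where b: "b = (ys, us)" by (cases b)
    with 3 have "us \<noteq> []" by (auto simp: synthetic_outputs_def)
    then show ?case using 3 b by (auto simp: synthetic_outputs_def interleave_pairs)
  qed (auto simp: synthetic_outputs_def pairs_interleave UNIV_bit[symmetric])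
  finally show ?thesis by simp
qed

abbreviation synthetic_mean :: "nat \<Rightarrow> nat \<Rightarrow> ('y::finite) channel \<Rightarrow> 'y channel \<Rightarrow> (real \<Rightarrow> real) \<Rightarrow> real" where
  "synthetic_mean n i W V \<equiv>
     ratio_mean (synthetic_outputs n i) (synthetic_channel n i W) (synthetic_channel n i V)"

lemma ratio_mean_ratio_mean:
  "ratio_mean Y W V (\<lambda>a. ratio_mean Y W V (\<lambda>b. f (h a b)))
    = (\<Sum>y\<in>Y. \<Sum>z\<in>Y. \<Sum>u\<in>{0, 1}. \<Sum>v\<in>{0, 1}. 1 / 2 * W u y * (1 / 2 * W v z *
        f (h (likelihood_ratio V u y) (likelihood_ratio V v z))))"
proof -
  have "ratio_mean Y W V (\<lambda>a. ratio_mean Y W V (\<lambda>b. f (h a b)))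
    = (\<Sum>y\<in>Y. \<Sum>u\<in>{0, 1}. \<Sum>z\<in>Y. \<Sum>v\<in>{0, 1}. 1 / 2 * W u y * (1 / 2 * W v z *
        f (h (likelihood_ratio V u y) (likelihood_ratio V v z))))"
    unfolding ratio_mean_def by (simp only: sum_distrib_left)
  also have "\<dots> = (\<Sum>y\<in>Y. \<Sum>z\<in>Y. \<Sum>u\<in>{0, 1}. \<Sum>v\<in>{0, 1}. 1 / 2 * W u y * (1 / 2 * W v z *
        f (h (likelihood_ratio V u y) (likelihood_ratio V v z))))"
    by (rule sum.cong[OF refl]) (rule sum.swap)
  finally show ?thesis .
qed

lemma synthetic_mean_minus:
  assumes "dominated W V" "i < 2 ^ n"
  shows "synthetic_mean (Suc n) (2 * i) W V f
    = synthetic_mean n i W V (\<lambda>a. synthetic_mean n i W V (\<lambda>b. f ((a + b) / (1 + a * b))))"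
proof -
  let ?W = "synthetic_channel n i W" and ?V = "synthetic_channel n i V"
  define G where "G y z = (\<Sum>u\<in>{0, 1}. 1 / 2 * (1 / 2 * (\<Sum>v\<in>{0, 1}. ?W (u + v) y * ?W v z)) *
      f ((1 / 2 * (\<Sum>v\<in>{0, 1}. ?V (u + 1 + v) y * ?V v z)) / (1 / 2 * (\<Sum>v\<in>{0, 1}. ?V (u + v) y * ?V v z))))"
    for y z
  have "synthetic_mean (Suc n) (2 * i) W V f = (\<Sum>(ys, us)\<in>synthetic_outputs (Suc n) (2 * i).
      G (take (2 ^ n) ys, pair_sums us) (drop (2 ^ n) ys, pair_seconds us))"
    unfolding ratio_mean_def likelihood_ratio_def G_def using assms(2)
    by (intro sum.cong refl) (auto simp only: synthetic_outputs_def mem_Collect_eq prod.case synthetic_channel_minus)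
  also have "\<dots> = (\<Sum>y\<in>synthetic_outputs n i. \<Sum>z\<in>synthetic_outputs n i. G y z)"
    by (rule sum_synthetic_outputs_minus)
  also have "\<dots> = (\<Sum>y\<in>synthetic_outputs n i. \<Sum>z\<in>synthetic_outputs n i.
      \<Sum>u\<in>{0, 1}. \<Sum>v\<in>{0, 1}. 1 / 2 * ?W u y * (1 / 2 * ?W v z *
      f ((likelihood_ratio ?V u y + likelihood_ratio ?V v z) / (1 + likelihood_ratio ?V u y * likelihood_ratio ?V v z))))"
    unfolding G_def
    by (simp only: sum_minus_ratio[OF dominated_synthetic_channel[OF assms(1)]])
  finally show ?thesis by (simp only: ratio_mean_ratio_mean[of _ _ _ f "\<lambda>a b. (a + b) / (1 + a * b)"])
qed

lemma synthetic_mean_plus: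
  assumes "i < 2 ^ n"
  shows "synthetic_mean (Suc n) (2 * i + 1) W V f
    = synthetic_mean n i W V (\<lambda>a. synthetic_mean n i W V (\<lambda>b. f (a * b)))"
proof -
  let ?W = "synthetic_channel n i W" and ?V = "synthetic_channel n i V"
  define G where "G s y z = (\<Sum>u\<in>{0, 1}. 1 / 2 * (1 / 2 * ?W (s + u) y * ?W u z) *
      f ((1 / 2 * ?V (s + (u + 1)) y * ?V (u + 1) z) / (1 / 2 * ?V (s + u) y * ?V u z)))" for s y z
  have "synthetic_mean (Suc n) (2 * i + 1) W V f = (\<Sum>(ys, us)\<in>synthetic_outputs (Suc n) (2 * i + 1).
      G (last us) (take (2 ^ n) ys, pair_sums (butlast us)) (drop (2 ^ n) ys, pair_seconds (butlast us)))"
  proof -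
    have "synthetic_channel (Suc n) (2 * i + 1) U u (ys, us)
        = 1 / 2 * synthetic_channel n i U (last us + u) (take (2 ^ n) ys, pair_sums (butlast us))
          * synthetic_channel n i U u (drop (2 ^ n) ys, pair_seconds (butlast us))"
      if "(ys, us) \<in> synthetic_outputs (Suc n) (2 * i + 1)" for U :: "'a channel" and u ys us
    proof -
      have len: "length us = 2 * i + 1" "length ys = 2 ^ Suc n"
        using that by (auto simp: synthetic_outputs_def)
      then obtain vs a where us: "us = vs @ [a]" by (cases us rule: rev_cases) auto
      with len have "length vs = 2 * i" by simp
      from synthetic_channel_plus[OF assms this len(2)] show ?thesis
        unfolding us butlast_snoc last_snoc .
    qed
    then show ?thesis
      unfolding ratio_mean_def likelihood_ratio_def G_def
      by (intro sum.cong refl) (auto simp only: prod.case)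
  qed
  also have "\<dots> = (\<Sum>y\<in>synthetic_outputs n i. \<Sum>z\<in>synthetic_outputs n i. \<Sum>s\<in>{0, 1}. G s y z)"
    by (rule sum_synthetic_outputs_plus)
  also have "\<dots> = (\<Sum>y\<in>synthetic_outputs n i. \<Sum>z\<in>synthetic_outputs n i.
      \<Sum>u\<in>{0, 1}. \<Sum>v\<in>{0, 1}. 1 / 2 * ?W u y * (1 / 2 * ?W v z *
      f (likelihood_ratio ?V u y * likelihood_ratio ?V v z)))"
    unfolding G_def by (simp only: sum_plus_ratio)
  finally show ?thesis by (simp only: ratio_mean_ratio_mean[of _ _ _ f "(*)"])
qed

lemma synthetic_mean_0: "synthetic_mean 0 0 W V = ratio_mean UNIV W V"
proof -
  have out: "synthetic_outputs 0 0 = (\<lambda>y. ([y], [])) ` (UNIV :: 'a set)"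
    by (auto simp: synthetic_outputs_def length_Suc_conv)
  have ch: "synthetic_channel 0 0 U u ([y], []) = U u y" for U :: "'a channel" and u y
    by (simp add: synthetic_channel_def polar_encode_def polar_generator_def)
  show ?thesis
    unfolding ratio_mean_def likelihood_ratio_def out
    by (subst sum.reindex) (auto simp: inj_on_def ch simp del: add_bit_eq_xor)
qed

lemma is_expectation_ratio_mean:
  assumes "dominated W V" "is_channel W"
  shows "is_expectation (ratio_mean UNIV W V)"
proof -
  have r: "0 \<le> likelihood_ratio V x y" for x y
    using assms(1) by (simp add: dominated_def likelihood_ratio_def)
  have "ratio_mean UNIV W V (\<lambda>_. 1) = 1 / 2 * (\<Sum>y\<in>UNIV. W 0 y) + 1 / 2 * (\<Sum>y\<in>UNIV. W 1 y)"
    unfolding ratio_mean_def by (simp add: sum.distrib sum_distrib_left)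
  also have "\<dots> = 1" using assms(2) by (simp add: is_channel_def)
  finally have 1: "ratio_mean UNIV W V (\<lambda>_. 1) = 1" .
  show ?thesis
    unfolding is_expectation_def
  proof (intro conjI allI impI 1)
    fix f g :: "real \<Rightarrow> real" and c
    show "ratio_mean UNIV W V (\<lambda>x. f x + g x) = ratio_mean UNIV W V f + ratio_mean UNIV W V g"
      "ratio_mean UNIV W V (\<lambda>x. c * f x) = c * ratio_mean UNIV W V f"
      unfolding ratio_mean_def by (simp_all add: sum.distrib sum_distrib_left algebra_simps)
    assume "\<forall>x\<ge>0. f x \<le> g x"
    then show "ratio_mean UNIV W V f \<le> ratio_mean UNIV W V g"
      unfolding ratio_mean_def using r assms
      by (intro sum_mono mult_left_mono) (auto simp: dominated_def)
  qed
qed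

section \<open>The tree of laws indexed by bit positions\<close>

text \<open>The \<open>n\<close> binary digits of \<open>i\<close>, highest first, list the steps: 0
  for minus and 1 for plus.\<close>

primrec node :: "nat \<Rightarrow> nat \<Rightarrow> law \<Rightarrow> law" where
  "node 0 i \<mu> = \<mu>"
| "node (Suc n) i \<mu> = (if even i then law_minus (node n (i div 2) \<mu>) else law_plus (node n (i div 2) \<mu>))"

lemma avg_eq_sum_node: "avg n (\<lambda>\<nu> _. g \<nu>) \<mu> k = (\<Sum>i<2 ^ n. g (node n i \<mu>)) / 2 ^ n"
proof (induction n arbitrary: g)
  case (Suc n)
  \<comment> \<open>\<open>avg\<close> unfolds at the first step but \<open>node\<close> at the
    last, so the last step is split off here.\<close>
  have "avg (Suc n) (\<lambda>\<nu> _. g \<nu>) \<mu> k = avg n (avg 1 (\<lambda>\<nu> _. g \<nu>)) \<mu> k"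
    using avg_append[of n 1 "\<lambda>\<nu> _. g \<nu>" \<mu> k] by simp
  also have "\<dots> = avg n (\<lambda>\<nu> _. (g (law_minus \<nu>) + g (law_plus \<nu>)) / 2) \<mu> k"
    by (simp add: avg.simps[abs_def])
  also have "\<dots> = (\<Sum>i<2 ^ n. (g (law_minus (node n i \<mu>)) + g (law_plus (node n i \<mu>))) / 2) / 2 ^ n"
    by (rule Suc)
  also have "\<dots> = (\<Sum>i<2 ^ n. g (node (Suc n) (2 * i) \<mu>) + g (node (Suc n) (2 * i + 1) \<mu>)) / 2 ^ Suc n"
    by (simp add: sum_divide_distrib)
  finally show ?case
    using sum_even_odd[of "\<lambda>i. g (node (Suc n) i \<mu>)" "2 ^ n"] by (simp only: power_Suc)
qed simp

definition base_law :: "('y::finite) channel \<Rightarrow> 'y channel \<Rightarrow> law" where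
  "base_law W V = Abs_law (ratio_mean UNIV W V)"

lemma mean_node:
  assumes "dominated W V" "is_channel W" "i < 2 ^ n"
  shows "mean (node n i (base_law W V)) = synthetic_mean n i W V"
  using assms(3)
proof (induction n arbitrary: i)
  case 0
  then show ?case
    using mean_Abs_law[OF is_expectation_ratio_mean[OF assms(1,2)]]
    by (simp add: base_law_def synthetic_mean_0)
next
  case (Suc n)
  define j where "j = i div 2"
  have j: "j < 2 ^ n" using Suc.prems by (simp add: j_def)
  show ?case
  proof (cases "even i")
    case True
    then have i: "i = 2 * j" by (simp add: j_def)
    show ?thesis
      by (rule ext) (simp add: i mean_law_minus Suc.IH[OF j] synthetic_mean_minus[OF assms(1) j])
  next
    case False
    then have i: "i = 2 * j + 1" by (simp add: j_def)
    show ?thesis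
      by (rule ext) (use synthetic_mean_plus[OF j, of W V] in \<open>simp add: i mean_law_plus Suc.IH[OF j]\<close>)
  qed
qed

text \<open>Where \<open>W\<close> has mass, \<open>V x y / output_dist V y = 2 / (1 + l)\<close>
  with \<open>l\<close> the likelihood ratio, so the logarithm is
  \<open>1 - log 2 (1 + l)\<close>.\<close>

lemma mismatched_info_eq:
  assumes "finite Y" "dominated W V"
  shows "mismatched_info Y W V = ereal (ratio_mean Y W V (\<lambda>_. 1) - ratio_mean Y W V (\<lambda>l. log 2 (1 + l)))"
proof -
  have "(if W x y = 0 then 0 else if V x y = 0 then - \<infinity>
        else ereal (1 / 2 * W x y * log 2 (V x y / output_dist V y)))
      = ereal (1 / 2 * W x y * 1 - 1 / 2 * W x y * log 2 (1 + likelihood_ratio V x y))" for x y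
  proof (cases "W x y = 0")
    case False
    then have p: "0 < V x y" "0 \<le> V (x + 1) y"
      using assms(2) by (auto simp: dominated_def less_le)
    have "output_dist V y = (V x y + V (x + 1) y) / 2"
      unfolding output_dist_def by (cases x) simp_all
    also have "\<dots> = V x y * (1 + likelihood_ratio V x y) / 2"
      using p by (simp add: likelihood_ratio_def distrib_left del: add_bit_eq_xor)
    finally have q: "output_dist V y = V x y * (1 + likelihood_ratio V x y) / 2" .
    have "V x y / output_dist V y = 2 / (1 + likelihood_ratio V x y)"
      unfolding q using p(1) by simp
    moreover have "0 \<le> likelihood_ratio V x y"
      using p by (simp add: likelihood_ratio_def del: add_bit_eq_xor)
    ultimately have "log 2 (V x y / output_dist V y) = 1 - log 2 (1 + likelihood_ratio V x y)"
      by (simp add: log_divide)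
    then show ?thesis using False p by (simp add: right_diff_distrib)
  qed simp
  then have "mismatched_info Y W V
      = ereal (\<Sum>y\<in>Y. \<Sum>x\<in>{0, 1}. 1 / 2 * W x y * 1 - 1 / 2 * W x y * log 2 (1 + likelihood_ratio V x y))"
    unfolding mismatched_info_def by (simp only: sum_ereal)
  then show ?thesis unfolding ratio_mean_def by (simp only: sum_subtractf)
qed

lemma information_set_eq:
  assumes "dominated W V" "is_channel W"
  shows "information_set n \<epsilon> W V = {i. i < 2 ^ n \<and> cross_entropy (node n i (base_law W V)) \<le> \<epsilon>}"
proof -
  have "mismatched_info (synthetic_outputs n i) (synthetic_channel n i W) (synthetic_channel n i V)
      = ereal (1 - cross_entropy (node n i (base_law W V)))" if "i < 2 ^ n" for i
    using mismatched_info_eq[OF finite_synthetic_outputs dominated_synthetic_channel[OF assms(1)], of n i]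
      mean_node[OF assms that] mean_const[of "node n i (base_law W V)" 1]
    by (simp add: cross_entropy_def)
  then show ?thesis unfolding information_set_def by auto
qed

section \<open>Error probability and capacity\<close>

text \<open>If all decisions based on the true past are right, the decoder's own past remains the
  true one. Hence a decoding failure implies a wrong decision of this genie-aided kind.\<close>

lemma sc_decode_correct:
  assumes "\<And>i. i \<in> A \<Longrightarrow> i < length us \<Longrightarrow> d i ys (take i us) = us ! i"
  shows "k \<le> length us \<Longrightarrow> sc_decode d A us ys k = take k us"
  by (induction k) (auto simp: Let_def assms take_Suc_conv_app_nth)

lemma mismatched_rule_error:
  assumes dom: "dominated W V" and d: "mismatched_rule n V d" and i: "i < 2 ^ n"
    and out: "(ys, hs) \<in> synthetic_outputs n i" and nz: "synthetic_channel n i W u (ys, hs) \<noteq> 0"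
    and err: "d i ys hs \<noteq> u"
  shows "1 \<le> log 2 (1 + likelihood_ratio (synthetic_channel n i V) u (ys, hs))"
proof -
  have "d i ys hs = u + 1" using err by (cases u; cases "d i ys hs") auto
  moreover have "is_arg_max (\<lambda>u. synthetic_channel n i V u (ys, hs)) (\<lambda>_. True) (d i ys hs)"
    using d i out unfolding mismatched_rule_def by blast
  ultimately have "synthetic_channel n i V u (ys, hs) \<le> synthetic_channel n i V (u + 1) (ys, hs)"
    by (auto simp: is_arg_max_def not_less simp del: add_bit_eq_xor)
  \<comment> \<open>Positivity excludes the default ratio 0.\<close>
  moreover have "0 < synthetic_channel n i V u (ys, hs)"
    using dominated_synthetic_channel[OF dom, of n i] nz by (auto simp: dominated_def less_le)
  ultimately have "2 \<le> 1 + likelihood_ratio (synthetic_channel n i V) u (ys, hs)"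
    unfolding likelihood_ratio_def by simp
  then show ?thesis by (simp add: le_log_iff)
qed

lemma sum_inputs_split:
  fixes F :: "bit list \<Rightarrow> bit \<Rightarrow> bit list \<Rightarrow> real"
  assumes "i < N"
  shows "(\<Sum>us | length us = N. F us (us ! i) (take i us))
    = (\<Sum>hs | length hs = i. \<Sum>u\<in>{0, 1}. \<Sum>vs | length vs = N - 1 - i. F (hs @ u # vs) u hs)"
proof -
  have N: "N = i + Suc (N - 1 - i)" using assms by simp
  have "(\<Sum>us | length us = N. F us (us ! i) (take i us))
      = (\<Sum>hs | length hs = i. \<Sum>us | length us = Suc (N - 1 - i). F (hs @ us) ((hs @ us) ! i) (take i (hs @ us)))"
    by (subst N) (rule sum_list_append)
  also have "\<dots> = (\<Sum>hs | length hs = i. \<Sum>u\<in>{0, 1}. \<Sum>vs | length vs = N - 1 - i. F (hs @ u # vs) u hs)"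
    unfolding sum_list_Suc by (intro sum.cong refl) auto
  finally show ?thesis .
qed

text \<open>Union bound over genie-aided errors. The indicator of each is at most
  \<open>log 2 (1 + l)\<close>, whose mean is the cross entropy of that position.\<close>

lemma error_probability_le:
  fixes W V :: "('y::finite) channel"
  assumes dom: "dominated W V" and W: "is_channel W" and d: "mismatched_rule n V d" and A: "A \<subseteq> {..<2 ^ n}"
  shows "error_probability n W A d \<le> (\<Sum>i\<in>A. cross_entropy (node n i (base_law W V)))"
proof -
  let ?U = "{us :: bit list. length us = 2 ^ n}" and ?Y = "{ys :: 'y list. length ys = 2 ^ n}"
  define p where "p us ys = 1 / 2 ^ (2 ^ n) * likelihood n W us ys" for us ys
  define bad where "bad i ys hs u = (of_bool (d i ys hs \<noteq> u) :: real)" for i ys hs u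
  have fin: "finite A" using A finite_subset by blast
  have p: "0 \<le> p us ys" for us ys
    using dom by (auto simp: p_def likelihood_def dominated_def intro!: prod_nonneg divide_nonneg_nonneg)
  have union: "of_bool (\<exists>i\<in>A. sc_decode d A us ys (2 ^ n) ! i \<noteq> us ! i) \<le> (\<Sum>i\<in>A. bad i ys (take i us) (us ! i))"
    if "us \<in> ?U" for us ys
  proof (cases "\<forall>i\<in>A. d i ys (take i us) = us ! i")
    case True
    then have "sc_decode d A us ys (2 ^ n) = us" using that sc_decode_correct[of A us d ys "2 ^ n"] by simp
    then show ?thesis by (simp add: bad_def sum_nonneg)
  next
    case False
    then obtain i where i: "i \<in> A" "bad i ys (take i us) (us ! i) = 1" by (auto simp: bad_def)
    have "bad i ys (take i us) (us ! i) \<le> (\<Sum>i\<in>A. bad i ys (take i us) (us ! i))"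
      using i fin by (intro member_le_sum) (auto simp: bad_def)
    then show ?thesis using i by (simp add: of_bool_def)
  qed
  have bit_error: "(\<Sum>us\<in>?U. \<Sum>ys\<in>?Y. p us ys * bad i ys (take i us) (us ! i))
      \<le> cross_entropy (node n i (base_law W V))" if "i \<in> A" for i
  proof -
    have i: "i < 2 ^ n" using that A by auto
    let ?H = "{hs :: bit list. length hs = i}"
    \<comment> \<open>The factor 1/2 is the uniform law of the current bit: \<open>p\<close> has
      weight \<open>1 / 2 ^ N\<close>, the synthetic channel \<open>1 / 2 ^ (N - 1)\<close>, where
      \<open>N = 2 ^ n\<close>.\<close>
    have sum_p: "(\<Sum>vs | length vs = 2 ^ n - 1 - i. p (hs @ u # vs) ys) = 1 / 2 * synthetic_channel n i W u (ys, hs)"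
      for hs u ys
    proof -
      have "(2::real) ^ (2 ^ n) = 2 * 2 ^ (2 ^ n - 1)"
        using power_Suc[of "2::real" "2 ^ n - 1"] by simp
      then show ?thesis unfolding p_def synthetic_channel_eq sum_distrib_left[symmetric] by simp
    qed
    have "(\<Sum>us\<in>?U. \<Sum>ys\<in>?Y. p us ys * bad i ys (take i us) (us ! i))
        = (\<Sum>ys\<in>?Y. \<Sum>us\<in>?U. p us ys * bad i ys (take i us) (us ! i))"
      by (rule sum.swap)
    also have "\<dots> = (\<Sum>ys\<in>?Y. \<Sum>hs\<in>?H. \<Sum>u\<in>{0, 1}. \<Sum>vs | length vs = 2 ^ n - 1 - i. p (hs @ u # vs) ys * bad i ys hs u)"
      by (rule sum.cong[OF refl]) (rule sum_inputs_split[OF i])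
    also have "\<dots> = (\<Sum>ys\<in>?Y. \<Sum>hs\<in>?H. \<Sum>u\<in>{0, 1}. 1 / 2 * synthetic_channel n i W u (ys, hs) * bad i ys hs u)"
      by (simp only: sum_distrib_right[symmetric] sum_p)
    also have "\<dots> = (\<Sum>(ys, hs)\<in>?Y \<times> ?H. \<Sum>u\<in>{0, 1}. 1 / 2 * synthetic_channel n i W u (ys, hs) * bad i ys hs u)"
      by (rule sum.cartesian_product)
    also have "?Y \<times> ?H = synthetic_outputs n i" by (auto simp: synthetic_outputs_def)
    also have "(\<Sum>(ys, hs)\<in>synthetic_outputs n i. \<Sum>u\<in>{0, 1}. 1 / 2 * synthetic_channel n i W u (ys, hs) * bad i ys hs u)
        \<le> synthetic_mean n i W V (\<lambda>l. log 2 (1 + l))"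
      unfolding ratio_mean_def
    proof (rule sum_mono, clarify, rule sum_mono)
      fix ys :: "'y list" and hs u assume out: "(ys, hs) \<in> synthetic_outputs n i"
      let ?l = "log 2 (1 + likelihood_ratio (synthetic_channel n i V) u (ys, hs))"
      have "0 \<le> synthetic_channel n i W u (ys, hs)"
        "0 \<le> likelihood_ratio (synthetic_channel n i V) u (ys, hs)"
        using dominated_synthetic_channel[OF dom, of n i]
        by (auto simp: dominated_def likelihood_ratio_def)
      then have "0 \<le> synthetic_channel n i W u (ys, hs)" "0 \<le> ?l" by simp_all
      moreover have "bad i ys hs u \<le> ?l" if "synthetic_channel n i W u (ys, hs) \<noteq> 0"
        using mismatched_rule_error[OF dom d i out that] \<open>0 \<le> ?l\<close> by (auto simp: bad_def of_bool_def)
      ultimately show "1 / 2 * synthetic_channel n i W u (ys, hs) * bad i ys hs u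
          \<le> 1 / 2 * synthetic_channel n i W u (ys, hs) * ?l"
        by (cases "synthetic_channel n i W u (ys, hs) = 0") (auto intro: mult_left_mono)
    qed
    finally show ?thesis by (simp add: cross_entropy_def mean_node[OF dom W i])
  qed
  have "error_probability n W A d = (\<Sum>us\<in>?U. \<Sum>ys\<in>?Y. p us ys * of_bool (\<exists>i\<in>A. sc_decode d A us ys (2 ^ n) ! i \<noteq> us ! i))"
    by (simp add: error_probability_def p_def likelihood_def)
  also have "\<dots> \<le> (\<Sum>us\<in>?U. \<Sum>ys\<in>?Y. p us ys * (\<Sum>i\<in>A. bad i ys (take i us) (us ! i)))"
    using p union by (intro sum_mono mult_left_mono) auto
  also have "\<dots> = (\<Sum>us\<in>?U. \<Sum>i\<in>A. \<Sum>ys\<in>?Y. p us ys * bad i ys (take i us) (us ! i))"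
    unfolding sum_distrib_left by (rule sum.cong[OF refl]) (rule sum.swap)
  also have "\<dots> = (\<Sum>i\<in>A. \<Sum>us\<in>?U. \<Sum>ys\<in>?Y. p us ys * bad i ys (take i us) (us ! i))"
    by (rule sum.swap)
  also have "\<dots> \<le> (\<Sum>i\<in>A. cross_entropy (node n i (base_law W V)))"
    by (intro sum_mono bit_error)
  finally show ?thesis .
qed

section \<open>Capacity on the closure of the class\<close>

lemma dominated_refl: "is_channel U \<Longrightarrow> dominated U U"
  by (auto simp: dominated_def is_channel_def)

lemma mismatched_info_channel:
  assumes "dominated W V" "is_channel W"
  shows "mismatched_info UNIV W V = ereal (1 - cross_entropy (base_law W V))"
  using mismatched_info_eq[of UNIV W V] assms mean_node[OF assms, of 0 0]
    mean_const[of "node 0 0 (base_law W V)" 1]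
  by (simp add: cross_entropy_def synthetic_mean_0)

text \<open>
  The absolute values make this continuous everywhere, not only at channels.
\<close>

definition capacity :: "('y::finite) channel \<Rightarrow> real" where
  "capacity U = (\<Sum>y\<in>UNIV. (\<Sum>x\<in>{0, 1}. 1 / 2 * (\<bar>U x y\<bar> * ln \<bar>U x y\<bar>)) - \<bar>output_dist U y\<bar> * ln \<bar>output_dist U y\<bar>) / ln 2"

text \<open>Rewriting as output entropy minus conditional entropy removes the quotient, and
  \<open>0 * ln 0 = 0\<close> absorbs the case distinction.\<close>

lemma symmetric_capacity_eq:
  assumes "is_channel U" shows "symmetric_capacity U = ereal (capacity U)"
proof -
  have nn: "0 \<le> U x y" for x y using assms by (simp add: is_channel_def)
  have "(if U x y = 0 then 0 else if U x y = 0 then - \<infinity> else ereal (1 / 2 * U x y * log 2 (U x y / output_dist U y)))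
      = ereal (1 / 2 * (\<bar>U x y\<bar> * ln \<bar>U x y\<bar>) / ln 2 - 1 / 2 * U x y * ln \<bar>output_dist U y\<bar> / ln 2)" for x y
  proof (cases "U x y = 0")
    case False
    then have "0 < U x y" "0 < output_dist U y"
      using nn[of 0 y] nn[of 1 y] nn[of x y] by (cases x; auto simp: output_dist_def less_le)+
    then show ?thesis by (simp add: log_def ln_div right_diff_distrib diff_divide_distrib)
  qed simp
  then have "symmetric_capacity U = ereal (\<Sum>y\<in>UNIV. \<Sum>x\<in>{0, 1}.
      1 / 2 * (\<bar>U x y\<bar> * ln \<bar>U x y\<bar>) / ln 2 - 1 / 2 * U x y * ln \<bar>output_dist U y\<bar> / ln 2)"
    unfolding symmetric_capacity_def mismatched_info_def by (simp only: sum_ereal)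
  moreover have "(\<Sum>x\<in>{0, 1}. 1 / 2 * (\<bar>U x y\<bar> * ln \<bar>U x y\<bar>) / ln 2 - 1 / 2 * U x y * ln \<bar>output_dist U y\<bar> / ln 2)
      = ((\<Sum>x\<in>{0, 1}. 1 / 2 * (\<bar>U x y\<bar> * ln \<bar>U x y\<bar>)) - \<bar>output_dist U y\<bar> * ln \<bar>output_dist U y\<bar>) / ln 2" for y
  proof -
    define q where "q = ln \<bar>output_dist U y\<bar>"
    have "\<bar>output_dist U y\<bar> = 1 / 2 * U 0 y + 1 / 2 * U 1 y"
      using nn[of 0 y] nn[of 1 y] by (simp add: output_dist_def)
    then have "\<bar>output_dist U y\<bar> * q = 1 / 2 * U 0 y * q + 1 / 2 * U 1 y * q"
      by (simp only: distrib_right)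
    then show ?thesis
      unfolding sum_bit q_def[symmetric] by (simp add: diff_divide_distrib add_divide_distrib)
  qed
  ultimately show ?thesis unfolding capacity_def by (simp only: sum_divide_distrib)
qed

lemma isCont_xlnx: "isCont (\<lambda>t::real. \<bar>t\<bar> * ln \<bar>t\<bar>) t"
proof (cases "t = 0")
  case True
  have "((\<lambda>t::real. \<bar>t\<bar> * ln \<bar>t\<bar>) \<longlongrightarrow> 0) (at 0)"
    unfolding filterlim_at_split by (intro conjI; real_asymp)
  then show ?thesis using True by (simp add: isCont_def)
qed (auto intro!: continuous_intros)

lemma continuous_on_capacity: "continuous_on UNIV (capacity :: ('y::finite) channel \<Rightarrow> real)"
proof -
  have U: "continuous_on UNIV (\<lambda>U :: 'y channel. U x y)" for x y
    by (intro continuous_on_product_then_coordinatewise[of UNIV "\<lambda>U. U x"]) simp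
  have c: "continuous_on UNIV (\<lambda>U :: 'y channel. \<bar>f U\<bar> * ln \<bar>f U\<bar>)" if "continuous_on UNIV f" for f :: "'y channel \<Rightarrow> real"
    using that isCont_xlnx
    by (intro continuous_on_compose2[of UNIV "\<lambda>t. \<bar>t\<bar> * ln \<bar>t\<bar>" UNIV f])
      (auto simp: continuous_on_eq_continuous_at)
  show ?thesis
    unfolding capacity_def output_dist_def by (intro continuous_intros c U) auto
qed

lemma closed_is_channel: "closed {U :: ('y::finite) channel. is_channel U}"
proof -
  have U: "continuous_on UNIV (\<lambda>U :: 'y channel. U x y)" for x y
    by (intro continuous_on_product_then_coordinatewise[of UNIV "\<lambda>U. U x"]) simp
  show ?thesis
    unfolding is_channel_def
    by (intro closed_Collect_conj closed_Collect_all closed_Collect_le closed_Collect_eq continuous_intros U)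
qed

text \<open>By continuity, a lower bound \<open>r\<close> for the capacity on the class extends to
  its closure, so the infimum over the class is the minimum over the closure.\<close>

lemma compound_capacity_eq:
  assumes ch: "\<forall>W\<in>\<W>. is_channel W" and V: "V \<in> closure \<W>"
    and min: "\<And>U. U \<in> closure \<W> \<Longrightarrow> symmetric_capacity V \<le> symmetric_capacity U"
  shows "compound_capacity \<W> = symmetric_capacity V" "is_channel V"
proof -
  have clos: "closure \<W> \<subseteq> {U. is_channel U}"
    using ch by (intro closure_minimal closed_is_channel) auto
  then show "is_channel V" using V by auto
  have "compound_capacity \<W> \<le> symmetric_capacity V"
  proof (rule ccontr)
    assume "\<not> ?thesis"
    then obtain r where r: "symmetric_capacity V < ereal r" "ereal r < compound_capacity \<W>"
      using ereal_dense2[of "symmetric_capacity V" "compound_capacity \<W>"] by (auto simp: not_le)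
    have "r \<le> capacity W" if "W \<in> \<W>" for W
    proof -
      have "compound_capacity \<W> \<le> ereal (capacity W)"
        unfolding compound_capacity_def using that ch by (auto intro: INF_lower2 simp: symmetric_capacity_eq)
      then show ?thesis using r by (meson ereal_less_eq(3) less_le_trans less_imp_le)
    qed
    then have "closure \<W> \<subseteq> {U. r \<le> capacity U}"
      by (intro closure_minimal closed_Collect_le continuous_on_capacity continuous_intros) auto
    then show False using V r \<open>is_channel V\<close> by (auto simp: symmetric_capacity_eq)
  qed
  moreover have "symmetric_capacity V \<le> compound_capacity \<W>"
    unfolding compound_capacity_def using closure_subset[of \<W>] by (intro INF_greatest min) auto
  ultimately show "compound_capacity \<W> = symmetric_capacity V" by simp
qed

text \<open>A single summand \<open>- \<infinity>\<close> makes the sum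
  \<open>- \<infinity>\<close>, since no summand is \<open>\<infinity>\<close>.\<close>

lemma dominated_if_mismatched_info:
  fixes W V :: "('y::finite) channel"
  assumes "is_channel W" "is_channel V" "mismatched_info UNIV W V \<noteq> - \<infinity>"
  shows "dominated W V"
proof (rule ccontr)
  assume "\<not> dominated W V"
  then obtain x y where xy: "W x y \<noteq> 0" "V x y = 0"
    using assms(1,2) by (auto simp: dominated_def is_channel_def)
  let ?f = "\<lambda>(y, x). if W x y = 0 then 0 else if V x y = 0 then - \<infinity>
    else ereal (1 / 2 * W x y * log 2 (V x y / output_dist V y))"
  have "sum ?f (UNIV \<times> {0, 1}) = - \<infinity>"
  proof -
    have "sum ?f (UNIV \<times> {0, 1}) = ?f (y, x) + sum ?f (UNIV \<times> {0, 1} - {(y, x)})"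
      by (intro sum.remove) (cases x; simp)+
    moreover have "sum ?f (UNIV \<times> {0, 1} - {(y, x)}) \<noteq> \<infinity>"
      by (auto simp: sum_Pinfty split: if_splits)
    ultimately show ?thesis using xy by simp
  qed
  then show False
    using assms(3) unfolding mismatched_info_def by (simp only: sum.cartesian_product)
qed

text \<open>Bernoulli's inequality \<open>(1 + l) powr \<rho> \<le> 1 + \<rho> * l\<close>. The
  final bound depends on \<open>V\<close> alone and is the source of uniformity over the
  class.\<close>

lemma excess_moment_base_law:
  assumes dom: "dominated W V" and W: "is_channel W" and \<rho>: "0 < \<rho>" "\<rho> \<le> 1"
  shows "excess_moment \<rho> (base_law W V) \<le> \<rho> * (\<Sum>y\<in>UNIV. \<Sum>x\<in>{0, 1}. likelihood_ratio V x y)"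
proof -
  have "(1 + l) powr \<rho> \<le> 1 + \<rho> * l" if "0 \<le> l" for l
    using Youngs_inequality_0[of \<rho> "1 - \<rho>" "1 + l" 1] \<rho> that by (simp add: algebra_simps)
  then have "mean (base_law W V) (\<lambda>l. (1 + l) powr \<rho>) \<le> mean (base_law W V) (\<lambda>l. 1 + \<rho> * l)"
    by (rule mean_mono)
  then have "excess_moment \<rho> (base_law W V) \<le> \<rho> * mean (base_law W V) (\<lambda>l. l)"
    by (simp add: excess_moment_def mean_add mean_cmult)
  also have "mean (base_law W V) (\<lambda>l. l) = ratio_mean UNIV W V (\<lambda>l. l)"
    using mean_node[OF dom W, of 0 0] by (simp add: synthetic_mean_0)
  also have "\<dots> \<le> (\<Sum>y\<in>UNIV. \<Sum>x\<in>{0, 1}. likelihood_ratio V x y)"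
    unfolding ratio_mean_def
  proof (intro sum_mono)
    fix x y
    have "W x y \<le> (\<Sum>y\<in>UNIV. W x y)"
      using W by (intro member_le_sum) (auto simp: is_channel_def)
    then have "1 / 2 * W x y \<le> 1" using W by (simp add: is_channel_def)
    moreover have "0 \<le> likelihood_ratio V x y"
      using dom by (simp add: dominated_def likelihood_ratio_def)
    ultimately show "1 / 2 * W x y * likelihood_ratio V x y \<le> likelihood_ratio V x y"
      using mult_right_mono[of "1 / 2 * W x y" 1] by simp
  qed
  finally show ?thesis using \<rho> by simp
qed

lemma threshold_bigo:
  assumes "\<beta> < 1 / 2"
  shows "threshold \<in> O(\<lambda>n. 2 powr - ((2 ^ n) powr \<beta>))"
proof -
  define c where "c = 1 / 2 - \<beta>"
  have "0 < c" using assms by (simp add: c_def)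
  then have "\<forall>\<^sub>F n in sequentially. real n powr (3 / 4) \<le> c * real n" by real_asymp
  then have "\<forall>\<^sub>F n in sequentially. norm (threshold n) \<le> 1 * norm ((2::real) powr - ((2 ^ n) powr \<beta>))"
  proof eventually_elim
    case (elim n)
    have "(2 ^ n) powr \<beta> = (2::real) powr (real n * \<beta>)"
      by (simp add: powr_realpow[symmetric] powr_powr)
    also have "\<dots> \<le> 2 powr (real n / 2 - real n powr (3 / 4))"
      using elim by (intro powr_mono) (auto simp: c_def algebra_simps)
    finally show ?case by (simp add: threshold_def)
  qed
  then show ?thesis by (rule landau_o.bigI[rotated]) simp
qed

lemma threshold_sum_tendsto: "(\<lambda>n. 2 ^ n * threshold n) \<longlonglongrightarrow> 0"
  unfolding threshold_def by real_asymp

lemma card_information_set: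
  assumes "dominated W V" "is_channel W"
  shows "real (card (information_set n \<epsilon> W V))
    = 2 ^ n * (1 - avg n (\<lambda>\<nu> _. of_bool (\<epsilon> < cross_entropy \<nu>)) (base_law W V) 0)"
proof -
  let ?X = "\<lambda>i. cross_entropy (node n i (base_law W V))"
  have "information_set n \<epsilon> W V = {..<2 ^ n} \<inter> {i. ?X i \<le> \<epsilon>}"
    by (auto simp: information_set_eq[OF assms])
  then have "real (card (information_set n \<epsilon> W V)) = (\<Sum>i<2 ^ n. of_bool (?X i \<le> \<epsilon>))"
    by (simp add: sum_of_bool_eq)
  also have "\<dots> = (\<Sum>i<2 ^ n. 1 - of_bool (\<epsilon> < ?X i))"
    by (intro sum.cong) auto
  finally show ?thesis by (simp add: avg_eq_sum_node sum_subtractf right_diff_distrib)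
qed

theorem theorem2:
  fixes \<W> :: "('y::finite) channel set" and V :: "'y channel"
  assumes "\<forall>W\<in>\<W>. symmetric_channel W"
    and "one_sided \<W>"
    and "V = (ARG_MIN symmetric_capacity U. U \<in> closure \<W>)"
  shows "compound_capacity \<W> = symmetric_capacity V \<and>
    (\<forall>R::real. ereal R < symmetric_capacity V \<longrightarrow>
      (\<exists>\<epsilon> :: nat \<Rightarrow> real.
        (\<forall>n. 0 < \<epsilon> n) \<and>
        (\<forall>\<beta><1/2. \<epsilon> \<in> O(\<lambda>n. 2 powr - ((2 ^ n) powr \<beta>))) \<and>
        (\<exists>n0. \<forall>n\<ge>n0. \<forall>W\<in>\<W>. 2 ^ n * R \<le> real (card (information_set n (\<epsilon> n) W V))) \<and>
        (\<forall>\<delta>>0. \<exists>n0. \<forall>n\<ge>n0. \<forall>W\<in>\<W>. \<forall>d. mismatched_rule n V d \<longrightarrow>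
           error_probability n W (information_set n (\<epsilon> n) W V) d \<le> \<delta>)))"
proof (intro conjI allI impI)
  have ch: "\<forall>W\<in>\<W>. is_channel W" using assms(1) by (simp add: symmetric_channel_def)
  \<comment> \<open>Existence of a minimizer ensures that the choice behind \<open>ARG_MIN\<close>
    is one.\<close>
  have "is_arg_min symmetric_capacity (\<lambda>U. U \<in> closure \<W>) V"
    using assms(2) unfolding assms(3) arg_min_def one_sided_def by (metis someI_ex)
  then have V: "V \<in> closure \<W>" and min: "\<And>U. U \<in> closure \<W> \<Longrightarrow> symmetric_capacity V \<le> symmetric_capacity U"
    by (auto simp: is_arg_min_linorder)
  show "compound_capacity \<W> = symmetric_capacity V" by (rule compound_capacity_eq[OF ch V min])
  have chV: "is_channel V" by (rule compound_capacity_eq[OF ch V min])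
  have capV: "symmetric_capacity V = ereal (1 - cross_entropy (base_law V V))"
    unfolding symmetric_capacity_def by (rule mismatched_info_channel[OF dominated_refl[OF chV] chV])
  have le: "symmetric_capacity V \<le> mismatched_info UNIV W V" if "W \<in> \<W>" for W
    using assms(2,3) that by (simp add: one_sided_def worst_channel_def)
  \<comment> \<open>One-sidedness bounds the mismatched information below by a finite capacity, so
    it is not \<open>- \<infinity>\<close>.\<close>
  have dom: "dominated W V" if "W \<in> \<W>" for W
    using le[OF that] capV that ch chV by (intro dominated_if_mismatched_info) auto
  fix R :: real assume R: "ereal R < symmetric_capacity V"
  define M where "M = (\<Sum>y\<in>UNIV. \<Sum>x\<in>{0, 1}. likelihood_ratio V x y)"
  have "0 \<le> M"
    unfolding M_def using chV by (intro sum_nonneg) (simp add: likelihood_ratio_def is_channel_def)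
  moreover have "cross_entropy (base_law V V) < 1 - R" using R capV by simp
  ultimately obtain n0 where n0: "\<And>n \<mu>. n0 \<le> n \<Longrightarrow> cross_entropy \<mu> \<le> cross_entropy (base_law V V) \<Longrightarrow>
      (\<forall>\<rho>. 0 < \<rho> \<and> \<rho> \<le> 1 \<longrightarrow> excess_moment \<rho> \<mu> \<le> \<rho> * M) \<Longrightarrow>
      avg n (\<lambda>\<nu> _. of_bool (threshold n < cross_entropy \<nu>)) \<mu> 0 \<le> 1 - R"
    using uniform_polarization[OF cross_entropy_nonneg[of "base_law V V"], of "1 - R" M] by metis
  have size: "2 ^ n * R \<le> real (card (information_set n (threshold n) W V))" if "n0 \<le> n" "W \<in> \<W>" for n W
  proof -
    have W: "is_channel W" using ch that by simp
    have "cross_entropy (base_law W V) \<le> cross_entropy (base_law V V)"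
      using le[OF that(2)] capV mismatched_info_channel[OF dom[OF that(2)] W] by simp
    then have "avg n (\<lambda>\<nu> _. of_bool (threshold n < cross_entropy \<nu>)) (base_law W V) 0 \<le> 1 - R"
      using that(1) excess_moment_base_law[OF dom[OF that(2)] W] by (intro n0) (auto simp: M_def)
    then show ?thesis
      unfolding card_information_set[OF dom[OF that(2)] W] by (intro mult_left_mono) auto
  qed
  \<comment> \<open>At most \<open>2 ^ n\<close> positions each contribute at most the threshold,
    whose doubly exponential decay beats their number.\<close>
  have error: "error_probability n W (information_set n (threshold n) W V) d \<le> 2 ^ n * threshold n"
    if "W \<in> \<W>" "mismatched_rule n V d" for n W d
  proof -
    have W: "is_channel W" using ch that by simp
    let ?A = "information_set n (threshold n) W V"
    have A: "?A = {i. i < 2 ^ n \<and> cross_entropy (node n i (base_law W V)) \<le> threshold n}"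
      by (rule information_set_eq[OF dom[OF that(1)] W])
    then have sub: "?A \<subseteq> {..<2 ^ n}" by auto
    have "error_probability n W ?A d \<le> (\<Sum>i\<in>?A. cross_entropy (node n i (base_law W V)))"
      by (rule error_probability_le[OF dom[OF that(1)] W that(2) sub])
    also have "\<dots> \<le> (\<Sum>i\<in>?A. threshold n)" using A by (intro sum_mono) auto
    also have "\<dots> = real (card ?A) * threshold n" by simp
    also have "\<dots> \<le> real (2 ^ n) * threshold n"
      using card_mono[OF _ sub] by (intro mult_right_mono) (auto simp: threshold_def)
    finally show ?thesis by simp
  qed
  have "\<exists>n1. \<forall>n\<ge>n1. \<forall>W\<in>\<W>. \<forall>d. mismatched_rule n V d \<longrightarrow>
      error_probability n W (information_set n (threshold n) W V) d \<le> \<delta>" if "0 < \<delta>" for \<delta> :: real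
  proof -
    have "\<forall>\<^sub>F n in sequentially. 2 ^ n * threshold n < \<delta>"
      using threshold_sum_tendsto that by (rule order_tendstoD)
    then obtain n1 where n1: "\<And>n. n1 \<le> n \<Longrightarrow> 2 ^ n * threshold n < \<delta>"
      unfolding eventually_sequentially by blast
    have "error_probability n W (information_set n (threshold n) W V) d \<le> \<delta>"
      if "n1 \<le> n" "W \<in> \<W>" "mismatched_rule n V d" for n W d
      using error[OF that(2,3)] n1[OF that(1)] by linarith
    then show ?thesis by blast
  qed
  then have "\<forall>\<delta>>0. \<exists>n1. \<forall>n\<ge>n1. \<forall>W\<in>\<W>. \<forall>d. mismatched_rule n V d \<longrightarrow>
      error_probability n W (information_set n (threshold n) W V) d \<le> \<delta>" by blast
  moreover have "\<forall>n. 0 < threshold n" by (simp add: threshold_def)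
  moreover have "\<forall>\<beta><1/2. threshold \<in> O(\<lambda>n. 2 powr - ((2 ^ n) powr \<beta>))"
    using threshold_bigo by blast
  moreover have "\<exists>n0. \<forall>n\<ge>n0. \<forall>W\<in>\<W>. 2 ^ n * R \<le> real (card (information_set n (threshold n) W V))"
    using size by blast
  ultimately show "\<exists>\<epsilon> :: nat \<Rightarrow> real.
        (\<forall>n. 0 < \<epsilon> n) \<and>
        (\<forall>\<beta><1/2. \<epsilon> \<in> O(\<lambda>n. 2 powr - ((2 ^ n) powr \<beta>))) \<and>
        (\<exists>n0. \<forall>n\<ge>n0. \<forall>W\<in>\<W>. 2 ^ n * R \<le> real (card (information_set n (\<epsilon> n) W V))) \<and>
        (\<forall>\<delta>>0. \<exists>n0. \<forall>n\<ge>n0. \<forall>W\<in>\<W>. \<forall>d. mismatched_rule n V d \<longrightarrow>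
           error_probability n W (information_set n (\<epsilon> n) W V) d \<le> \<delta>)"
    by (intro exI[of _ threshold] conjI)
qed

end
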